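(* Let $n\ge1$. In a lozenge tiling of $n\Delta_2$ with numbered unit triangles, the (acyclic) system of permutations determines uniquely the numbered positions of the unit triangles. Conversely, the numbered positions of the unit triangles together with one permutation of the system determine uniquely the other two permutations. That is, let $T$ and $T'$ be lozenge tilings of $n\Delta_2$, each with its unit triangles numbered by $1,\dots,n$, with systems of permutations $(u,v,w)$ and $(u',v',w')$. (1) If $(u,v,w)=(u',v',w')$, then for every $i\in[n]$ the $i$th unit triangle of $T$ and the $i$th unit triangle of $T'$ have the same position. (2) If for every $i\in[n]$ the $i$th unit triangles of $T$ and $T'$ have the same position, and at least one of the equalities $u=u'$, $v=v'$, $w=w'$ holds, then $(u,v,w)=(u',v',w')$.
   Context: Notation: $[n]=\{1,\dots,n\}$. Permutations of $[n]$ are written as words in one-line notation. Triangle and tilings: $n\Delta_2=\{x\in\mathbb R^3: x_1,x_2,x_3\ge 0,\ x_1+x_2+x_3=n\}$ is drawn as an equilateral triangle of side $n$ with top vertex $A=(n,0,0)$, lower left vertex $B=(0,n,0)$ and lower right vertex $C=(0,0,n)$. The lines $x_a\in\mathbb Z$ divide it into unit equilateral triangles pointing upward and unit triangles pointing downward. The upward ones are those of the form $x+\Delta_2$, with $\Delta_2$ the convex hull of the standard basis vectors and $x=(x_1,x_2,x_3)$ a vector of non-negative integers with sum $n-1$; $x$ is called the position of this upward unit triangle. A unit rhombus is the union of two of these unit triangles sharing a side. A lozenge tiling of $n\Delta_2$ is a subdivision of $n\Delta_2$ into upward unit triangles and unit rhombi. Every lozenge tiling has exactly $n$ unit triangles.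 System of permutations of a lozenge tiling: number the $n$ unit triangles of the tiling by $1,\dots,n$. From each of the three sides of triangle $i$, color $i$ spreads away from the triangle: if the side is not on the boundary of $n\Delta_2$, it is a side of a rhombus of the tiling; cross that rhombus to its opposite (parallel) side, and continue in this way until the boundary of $n\Delta_2$ is reached. Starting from the side parallel to an edge $e$ of $n\Delta_2$, one ends at a unit segment of $e$, which receives the number $i$. In this way each of the $n$ unit segments of each edge of $n\Delta_2$ receives exactly one number in $[n]$. Reading these numbers clockwise around the triangle starting at the lower left vertex gives three permutations of $[n]$: $u$ (read along the edge from $B$ to $A$), $v$ (from $A$ to $C$) and $w$ (from $C$ to $B$). The triple $(u,v,w)$ is the system of permutations of the numbered tiling. (It is always acyclic: there are no $i\neq j$ such that $i$ precedes $j$ in all three words.) *)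

theory Defs
  imports "HOL-Analysis.Analysis"
begin

definition dilated_triangle :: "nat \<Rightarrow> (real ^ 3) set" where
  "dilated_triangle n = {x. (\<forall>a. 0 \<le> x $ a) \<and> (\<Sum>a\<in>UNIV. x $ a) = real n}"

definition up_positions :: "nat \<Rightarrow> (real ^ 3) set" where
  "up_positions n = {x. (\<forall>a. x $ a \<in> \<nat>) \<and> (\<Sum>a\<in>UNIV. x $ a) = real n - 1}"

definition up_triangle :: "real ^ 3 \<Rightarrow> (real ^ 3) set" where
  "up_triangle x = (+) x ` (convex hull (range (\<lambda>a. axis a 1)))"

(* In the plane of coordinate sum n, the cells cut out by the lines x_a = integer that do not point
   upward are y + conv {e_1 + e_2, e_1 + e_3, e_2 + e_3}, where y is a vector of non-negative
   integers with sum n - 2.  Below, 1 is the all-ones vector. *)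
definition down_positions :: "nat \<Rightarrow> (real ^ 3) set" where
  "down_positions n = {y. (\<forall>a. y $ a \<in> \<nat>) \<and> (\<Sum>a\<in>UNIV. y $ a) = real n - 2}"

definition down_triangle :: "real ^ 3 \<Rightarrow> (real ^ 3) set" where
  "down_triangle y = (+) y ` (convex hull (range (\<lambda>a. 1 - axis a 1)))"

definition up_triangles :: "nat \<Rightarrow> (real ^ 3) set set" where
  "up_triangles n = up_triangle ` up_positions n"

definition unit_triangles :: "nat \<Rightarrow> (real ^ 3) set set" where
  "unit_triangles n = up_triangles n \<union> down_triangle ` down_positions n"

definition unit_rhombi :: "nat \<Rightarrow> (real ^ 3) set set" where
  "unit_rhombi n = {P \<union> Q | P Q. P \<in> unit_triangles n \<and> Q \<in> unit_triangles n \<and> P \<noteq> Q \<and>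
                                  (\<exists>s. s edge_of P \<and> s edge_of Q)}"

(* All tiles are two-dimensional and lie in one plane, so rel_interior is the interior in that
   plane. *)
definition lozenge_tiling :: "nat \<Rightarrow> (real ^ 3) set set \<Rightarrow> bool" where
  "lozenge_tiling n T \<longleftrightarrow>
     T \<subseteq> up_triangles n \<union> unit_rhombi n \<and>
     \<Union>T = dilated_triangle n \<and>
     pairwise (\<lambda>P Q. rel_interior P \<inter> rel_interior Q = {}) T"

(* A numbering of the unit triangles of T by 1, ..., n is recorded through positions: p i is the
   position of the i-th unit triangle. *)
definition numbering :: "nat \<Rightarrow> (real ^ 3) set set \<Rightarrow> (nat \<Rightarrow> real ^ 3) \<Rightarrow> bool" where
  "numbering n T p \<longleftrightarrow> bij_betw p {1..n} {x \<in> up_positions n. up_triangle x \<in> T}"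

definition opposite_sides :: "(real ^ 3) set \<Rightarrow> (real ^ 3) set \<Rightarrow> (real ^ 3) set \<Rightarrow> bool" where
  "opposite_sides R s s' \<longleftrightarrow> s edge_of R \<and> s' edge_of R \<and> s \<noteq> s' \<and> (\<exists>d. s' = (+) d ` s)"

(* spreads n T t Q s: the color of the unit triangle t leaves the tile Q (either t itself or a
   rhombus that has just been crossed) through its side s. *)
inductive spreads ::
  "nat \<Rightarrow> (real ^ 3) set set \<Rightarrow> (real ^ 3) set \<Rightarrow> (real ^ 3) set \<Rightarrow> (real ^ 3) set \<Rightarrow> bool"
  for n :: nat and T :: "(real ^ 3) set set" and t :: "(real ^ 3) set"
  where
    start: "s edge_of t \<Longrightarrow> spreads n T t t s"
  | cross: "spreads n T t Q s \<Longrightarrow> R \<in> T \<Longrightarrow> R \<in> unit_rhombi n \<Longrightarrow> R \<noteq> Q \<Longrightarrow>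
            opposite_sides R s s' \<Longrightarrow> spreads n T t R s'"

(* For a boundary segment s of a numbered tiling, the unique number i in {1..n} it receives. *)
definition received :: "nat \<Rightarrow> (real ^ 3) set set \<Rightarrow> (nat \<Rightarrow> real ^ 3) \<Rightarrow> (real ^ 3) set \<Rightarrow> nat" where
  "received n T p s = (THE i. i \<in> {1..n} \<and> (\<exists>Q. spreads n T (up_triangle (p i)) Q s))"

(* The unit segments of the edge from the vertex n e_a to the vertex n e_b, in this order, for
   j = 0, ..., n - 1. *)
definition edge_segment :: "nat \<Rightarrow> 3 \<Rightarrow> 3 \<Rightarrow> nat \<Rightarrow> (real ^ 3) set" where
  "edge_segment n a b j =
     closed_segment (axis a (real n - real j) + axis b (real j))
                    (axis a (real n - real (Suc j)) + axis b (real (Suc j)))"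

definition edge_word ::
  "nat \<Rightarrow> (real ^ 3) set set \<Rightarrow> (nat \<Rightarrow> real ^ 3) \<Rightarrow> 3 \<Rightarrow> 3 \<Rightarrow> nat list" where
  "edge_word n T p a b = map (\<lambda>j. received n T p (edge_segment n a b j)) [0..<n]"

(* The words u (from B to A), v (from A to C) and w (from C to B), where A = n e_1, B = n e_2 and
   C = n e_3. *)
definition system_of_permutations ::
  "nat \<Rightarrow> (real ^ 3) set set \<Rightarrow> (nat \<Rightarrow> real ^ 3) \<Rightarrow> nat list \<times> nat list \<times> nat list" where
  "system_of_permutations n T p = (edge_word n T p 2 1, edge_word n T p 1 3, edge_word n T p 3 2)"

end

theory Submission
  imports Defs
begin

text \<open>
  A tiling pairs every downward unit triangle with an adjacent upward one.  In these terms color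
  \<open>i\<close> spreads in direction \<open>a\<close> along a path of upward triangles, its ray, on which coordinate \<open>a\<close>
  drops by 1 at each step until the edge \<open>x\<^sub>a = 0\<close> is reached.  Rays in the same direction are
  disjoint and preserve their order (\<open>ray_disjoint\<close>, \<open>ray_order\<close>), and knowing the word on an edge
  amounts to knowing where each color arrives on it (\<open>edge_word_eq_iff\<close>).

  The heart of the proof is a formula for the positions (\<open>coordinate_eq_card_farther\<close>): coordinate
  \<open>a\<close> of unit triangle \<open>i\<close> is the number of colors that arrive farther from the vertex \<open>a\<close> than \<open>i\<close> on
  both edges at that vertex.  To see that there are at least that many such colors, consider the line
  \<open>x\<^sub>a = h\<close> on which the unit triangle \<open>i\<close> rests, and let \<open>r\<close> be the number of rhombi that this line
  cuts along a diagonal.  Each unit triangle on or above the line sends its ray in direction \<open>a\<close> through a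
  different one of the other \<open>n - h - r\<close> segments of the line, so at least \<open>h + r\<close> unit triangles lie
  below.  A color from below that does not arrive farther than \<open>i\<close> on one of the two edges must have
  climbed through one of the \<open>r\<close> rhombi, on the left of \<open>i\<close> for one edge and on the right for the
  other.  This excludes at most \<open>r\<close> colors and leaves \<open>h\<close>.  Equality follows by summation: the
  coordinates of a position add up to \<open>n - 1\<close>, and no color can be counted for two vertices, since
  being farther from one end of an edge is being nearer to the other end.

  The formula shows that the three words determine the positions.  For the converse it says that the
  coordinates \<open>a\<close> of the positions count non-inversions between the orders of arrival on the two edges
  at \<open>a\<close>.  These counts form a Lehmer code, so the order on one edge and the positions determine the
  order on the other edge (\<open>order_determined_by_noninversions\<close>).

  The geometric part identifies the sides of the tiles.  Each is a side of a unique upward triangle;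
  a rhombus has two parallel sides in each of the two directions different from that of the diagonal
  along which it is glued, and this makes the inductively defined spreading of colors agree with the
  rays.
\<close>

section \<open>Directions and positions\<close>

text \<open>Statements about the three directions are proved for arbitrary distinct \<open>a\<close>, \<open>b\<close>, \<open>c\<close>, so that no
  argument has to be repeated for every vertex of the big triangle; these two facts split
  quantifiers and sums accordingly.\<close>
lemma three_directions:
  fixes a b c :: 3
  assumes "a \<noteq> b" "a \<noteq> c" "b \<noteq> c"
  shows "(\<forall>d. P d) \<longleftrightarrow> P a \<and> P b \<and> P c"
    and "(\<Sum>d\<in>UNIV. f d) = f a + (f b + (f c :: 'a :: comm_monoid_add))"
proof -
  have "card {a, b, c} = CARD(3)"
    using assms by simp
  then have *: "UNIV = {a, b, c}"
    using card_subset_eq[of UNIV "{a, b, c}"] by simp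
  show "(\<forall>d. P d) \<longleftrightarrow> P a \<and> P b \<and> P c"
    using * by (metis UNIV_I empty_iff insert_iff)
  show "(\<Sum>d\<in>UNIV. f d) = f a + (f b + f c)"
    unfolding * using assms by simp
qed

lemma third_direction:
  fixes a b :: 3
  assumes "a \<noteq> b"
  obtains c where "c \<noteq> a" "c \<noteq> b"
proof -
  have "card {a, b} < CARD(3)"
    using assms by simp
  then have "{a, b} \<noteq> UNIV"
    by (metis less_irrefl)
  then show ?thesis
    using that by auto
qed

lemma other_directions:
  fixes a :: 3
  obtains b c where "b \<noteq> a" "c \<noteq> a" "b \<noteq> c"
proof -
  obtain b where "b \<noteq> a"
    by (metis(full_types) one_neq_zero)
  then show ?thesis
    using third_direction[of a b] that by metis
qed

lemma Nats_less_imp_add1_le: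
  fixes s t :: real
  assumes "s \<in> \<nat>" "t \<in> \<nat>" "s < t"
  shows "s + 1 \<le> t"
  using assms by (auto elim!: Nats_cases)

lemma Nats_diff_1:
  fixes s :: real
  assumes "s \<in> \<nat>" "1 \<le> s"
  shows "s - 1 \<in> \<nat>"
proof -
  obtain k where "s = real k"
    using assms Nats_cases by blast
  then have "s - 1 = real (k - 1)"
    using assms by simp
  then show ?thesis
    by simp
qed

lemma up_positionsD:
  assumes "x \<in> up_positions n"
  shows "x $ a \<in> \<nat>" "(\<Sum>d\<in>UNIV. x $ d) = real n - 1"
  using assms by (auto simp: up_positions_def)

lemma down_positionsD:
  assumes "y \<in> down_positions n"
  shows "y $ a \<in> \<nat>" "(\<Sum>d\<in>UNIV. y $ d) = real n - 2"
  using assms by (auto simp: down_positions_def)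

lemma sum_axis_1: "(\<Sum>d\<in>UNIV. axis a (1::real) $ (d::'n::finite)) = 1"
  by (simp add: axis_def)

lemma down_positions_raise:
  assumes "y \<in> down_positions n"
  shows "y + axis a 1 \<in> up_positions n"
  using assms
  by (auto simp: up_positions_def down_positions_def sum.distrib sum_axis_1 axis_def)

lemma up_positions_lower:
  assumes "x \<in> up_positions n" "1 \<le> x $ a"
  shows "x - axis a 1 \<in> down_positions n"
  using assms
  by (auto simp: up_positions_def down_positions_def sum_subtractf sum_axis_1 axis_def Nats_diff_1)

lemma up_positions_eqI:
  assumes "x \<in> up_positions n" "x' \<in> up_positions n" "a \<noteq> b"
    and "x $ a = x' $ a" "x $ b = x' $ b"
  shows "x = x'"
proof -
  obtain c where c: "c \<noteq> a" "c \<noteq> b"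
    using third_direction[OF assms(3)] .
  have "x $ c = x' $ c"
    using up_positionsD(2)[OF assms(1)] up_positionsD(2)[OF assms(2)] assms c
    by (simp add: three_directions(2)[of a b c])
  then show ?thesis
    using assms c by (simp add: vec_eq_iff three_directions(1)[of a b c])
qed

lemma card_row:
  fixes h :: nat and a :: 3
  shows "finite {x \<in> up_positions n. x $ a = real h}"
    and "card {x \<in> up_positions n. x $ a = real h} \<le> n - h"
proof -
  define R where "R = {x \<in> up_positions n. x $ a = real h}"
  obtain b c where bc: "b \<noteq> a" "c \<noteq> a" "b \<noteq> c"
    by (rule other_directions)
  have inj: "inj_on (\<lambda>x. x $ b) R"
    using bc by (auto simp: inj_on_def R_def intro: up_positions_eqI[of _ n _ a b])
  have sub: "(\<lambda>x. x $ b) ` R \<subseteq> real ` {..<n - h}"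
  proof
    fix t assume "t \<in> (\<lambda>x. x $ b) ` R"
    then obtain x where x: "x \<in> up_positions n" "x $ a = real h" "t = x $ b"
      by (auto simp: R_def)
    obtain k l where kl: "x $ b = real k" "x $ c = real l"
      by (metis x(1) up_positionsD(1) Nats_cases)
    have "real h + (real k + real l) = real n - 1"
      using up_positionsD(2)[OF x(1)] x kl bc by (simp add: three_directions(2)[of a b c])
    then have "k < n - h"
      by linarith
    then show "t \<in> real ` {..<n - h}"
      using x kl by auto
  qed
  have "finite ((\<lambda>x. x $ b) ` R)"
    using sub finite_subset by blast
  then show "finite R"
    using inj finite_imageD by blast
  have "card R = card ((\<lambda>x. x $ b) ` R)"
    using inj by (simp add: card_image)
  also have "\<dots> \<le> card (real ` {..<n - h})"
    using sub by (intro card_mono) auto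
  also have "\<dots> \<le> n - h"
    using card_image_le[of "{..<n - h}" real] by simp
  finally show "card R \<le> n - h" .
qed

section \<open>Rays in a matching of triangles\<close>

text \<open>A lozenge tiling, reduced to combinatorics: every downward triangle \<open>y\<close> forms a rhombus with the
  upward triangle \<open>y + axis (mate y) 1\<close>, different downward triangles use different upward ones, and
  \<open>U\<close> consists of upward triangles that no rhombus uses.\<close>
locale rhombus_matching =
  fixes n :: nat and mate :: "real ^ 3 \<Rightarrow> 3" and U :: "(real ^ 3) set"
  assumes mate_inj: "inj_on (\<lambda>y. y + axis (mate y) 1) (down_positions n)"
    and units_up: "U \<subseteq> up_positions n"
    and units_unmatched: "y \<in> down_positions n \<Longrightarrow> y + axis (mate y) 1 \<notin> U"
    and finite_units: "finite U"
    and card_units: "card U = n"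
begin

text \<open>The side of the upward triangle \<open>x\<close> opposite to its vertex \<open>x + axis c 1\<close> is shared with the downward
  triangle \<open>x - axis c 1\<close>.  Crossing the rhombus that contains the latter leads to the parallel side of
  the upward triangle in that rhombus.\<close>
definition step :: "3 \<Rightarrow> real ^ 3 \<Rightarrow> real ^ 3" where
  "step c x = x - axis c 1 + axis (mate (x - axis c 1)) 1"

definition ray :: "3 \<Rightarrow> real ^ 3 \<Rightarrow> nat \<Rightarrow> real ^ 3" where
  "ray c x k = (step c ^^ k) x"

lemma ray_0: "ray c x 0 = x"
  and ray_Suc: "ray c x (Suc k) = step c (ray c x k)"
  by (simp_all add: ray_def)

lemma mate_eqD:
  assumes "y + axis (mate y) 1 = y' + axis (mate y') 1"
    and "y \<in> down_positions n" "y' \<in> down_positions n"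
  shows "y = y'"
  using assms mate_inj by (auto dest: inj_onD)

text \<open>A ray in direction \<open>c\<close> never meets an upward triangle whose rhombus is glued along its side in
  direction \<open>c\<close>: it starts at an unmatched triangle, and it enters every later one through a rhombus
  glued along another side.  This invariant makes every step lower the coordinate \<open>c\<close> by 1.\<close>
lemma ray_on_row:
  assumes "x \<in> U" "real k \<le> x $ c"
  shows ray_up: "ray c x k \<in> up_positions n"
    and ray_level: "ray c x k $ c = x $ c - real k"
    and ray_active: "\<And>y. y \<in> down_positions n \<Longrightarrow> y + axis (mate y) 1 = ray c x k \<Longrightarrow> mate y \<noteq> c"
proof -
  have "ray c x k \<in> up_positions n \<and> ray c x k $ c = x $ c - real k \<and>
    (\<forall>y\<in>down_positions n. y + axis (mate y) 1 = ray c x k \<longrightarrow> mate y \<noteq> c)"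
    using assms(2)
  proof (induction k)
    case 0
    then show ?case
      using assms(1) units_up units_unmatched by (auto simp: ray_0)
  next
    case (Suc k)
    define z y where "z = ray c x k" and "y = z - axis c 1"
    have z: "z \<in> up_positions n" "z $ c = x $ c - real k"
        "\<And>y. y \<in> down_positions n \<Longrightarrow> y + axis (mate y) 1 = z \<Longrightarrow> mate y \<noteq> c"
      using Suc by (auto simp: z_def)
    have y: "y \<in> down_positions n"
      using z Suc.prems by (auto simp: y_def intro!: up_positions_lower)
    have "mate y \<noteq> c"
      using z(3)[OF y] by (auto simp: y_def)
    moreover have "ray c x (Suc k) = y + axis (mate y) 1"
      by (simp add: ray_Suc step_def y_def z_def)
    moreover have "(y + axis (mate y) 1) $ c = z $ c - 1"
      using \<open>mate y \<noteq> c\<close> by (simp add: y_def axis_def)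
    ultimately show ?case
      using z(2) y mate_eqD[OF _ _ y] down_positions_raise[OF y] by auto
  qed
  then show "ray c x k \<in> up_positions n" "ray c x k $ c = x $ c - real k"
    "\<And>y. y \<in> down_positions n \<Longrightarrow> y + axis (mate y) 1 = ray c x k \<Longrightarrow> mate y \<noteq> c"
    by auto
qed

lemma ray_cross:
  assumes "x \<in> U" "real (Suc k) \<le> x $ c"
  obtains y where "y \<in> down_positions n" "ray c x k = y + axis c 1"
    "ray c x (Suc k) = y + axis (mate y) 1" "mate y \<noteq> c"
proof -
  define y where "y = ray c x k - axis c 1"
  have k: "real k \<le> x $ c"
    using assms(2) by simp
  have y: "y \<in> down_positions n"
    unfolding y_def using assms ray_up[OF assms(1) k] ray_level[OF assms(1) k]
    by (intro up_positions_lower) auto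
  have "mate y \<noteq> c"
    using ray_active[OF assms(1) k y] by (auto simp: y_def)
  then show ?thesis
    using that[OF y] by (simp add: ray_Suc step_def y_def)
qed

text \<open>Steps can be undone: the triangle that a step arrives at determines the rhombus just crossed, by
  injectivity of the matching.  Going back, two rays that meet reach their starting triangles
  simultaneously, because a starting triangle is not matched.\<close>
lemma ray_disjoint:
  assumes "x \<in> U" "x' \<in> U" "real k \<le> x $ c" "real l \<le> x' $ c" "ray c x k = ray c x' l"
  shows "x = x'"
  using assms(3-)
proof (induction k arbitrary: l)
  case 0
  show ?case
  proof (cases l)
    case (Suc l')
    then show ?thesis
      using ray_cross[of x' l' c] 0 assms units_unmatched by (metis ray_0)
  qed (use 0 in \<open>simp add: ray_0\<close>)
next
  case (Suc k)
  obtain y where y: "y \<in> down_positions n" "ray c x k = y + axis c 1"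
    "ray c x (Suc k) = y + axis (mate y) 1"
    using ray_cross[OF assms(1) Suc.prems(1)] by metis
  show ?case
  proof (cases l)
    case 0
    then show ?thesis
      using y Suc.prems assms units_unmatched by (metis ray_0)
  next
    case (Suc l')
    obtain y' where y': "y' \<in> down_positions n" "ray c x' l' = y' + axis c 1"
      "ray c x' (Suc l') = y' + axis (mate y') 1"
      using ray_cross[of x' l' c] assms Suc.prems Suc by metis
    have "y = y'"
      using mate_eqD y y' Suc.prems Suc by metis
    then show ?thesis
      using Suc.IH[of l'] Suc.prems Suc y y' by simp
  qed
qed

lemma ray_mono:
  assumes "x \<in> U" "real k \<le> x $ b" "a \<noteq> b"
  shows "x $ a \<le> ray b x k $ a"
  using assms(2)
proof (induction k)
  case (Suc k)
  obtain y where "ray b x k = y + axis b 1" "ray b x (Suc k) = y + axis (mate y) 1"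
    using ray_cross[OF assms(1) Suc.prems] by metis
  then have "ray b x k $ a \<le> ray b x (Suc k) $ a"
    using assms(3) by (simp add: axis_def)
  then show ?case
    using Suc by simp
qed (simp add: ray_0)

text \<open>In one step the coordinate \<open>a\<close> grows by 0 or 1, so two rays in the same row that differ in this
  coordinate cannot change their order without meeting.\<close>
lemma ray_order:
  assumes "x \<in> U" "x' \<in> U" "a \<noteq> b"
    and "ray b x k $ b = ray b x' k' $ b" "ray b x k $ a < ray b x' k' $ a"
    and "real (k + l) \<le> x $ b" "real (k' + l) \<le> x' $ b"
  shows "ray b x (k + l) $ a < ray b x' (k' + l) $ a"
  using assms(6-)
proof (induction l)
  case (Suc l)
  obtain y where y: "y \<in> down_positions n" "ray b x (k + l) = y + axis b 1"
    "ray b x (Suc (k + l)) = y + axis (mate y) 1" "mate y \<noteq> b"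
    using ray_cross[OF assms(1), of "k + l" b] Suc.prems by auto
  obtain y' where y': "y' \<in> down_positions n" "ray b x' (k' + l) = y' + axis b 1"
    "ray b x' (Suc (k' + l)) = y' + axis (mate y') 1" "mate y' \<noteq> b"
    using ray_cross[OF assms(2), of "k' + l" b] Suc.prems by auto
  have lt: "y $ a < y' $ a"
    using Suc y y' assms(3) by (simp add: axis_def)
  then have "y $ a + 1 \<le> y' $ a"
    using Nats_less_imp_add1_le down_positionsD(1) y(1) y'(1) by blast
  moreover have "y $ b = y' $ b"
  proof -
    have "real (Suc (k + l)) \<le> x $ b" "real (Suc (k' + l)) \<le> x' $ b"
      using Suc.prems by auto
    then have "ray b x (k + l) $ b = ray b x' (k' + l) $ b"
      using assms(4) ray_level[OF assms(1), of "k + l" b] ray_level[OF assms(1), of k b]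
        ray_level[OF assms(2), of "k' + l" b] ray_level[OF assms(2), of k' b] by simp
    then show ?thesis
      using y y' by simp
  qed
  moreover have False if "ray b x (Suc (k + l)) $ a = ray b x' (Suc (k' + l)) $ a"
  proof -
    have "y + axis (mate y) 1 = y' + axis (mate y') 1"
      using that y y' \<open>y $ b = y' $ b\<close> assms(3)
      by (intro up_positions_eqI[of _ n _ a b] down_positions_raise) (auto simp: axis_def)
    then show False
      using lt mate_eqD y(1) y'(1) by blast
  qed
  ultimately have "ray b x (Suc (k + l)) $ a < ray b x' (Suc (k' + l)) $ a"
    using y y' by (force simp: axis_def)
  then show ?case
    by simp
qed (use assms in simp)

text \<open>The number of steps is the coordinate \<open>c\<close> of \<open>x\<close>, so that the ray ends in the row next to the edge
  where this coordinate vanishes.\<close>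
definition endpoint :: "3 \<Rightarrow> real ^ 3 \<Rightarrow> real ^ 3" where
  "endpoint c x = ray c x (nat \<lfloor>x $ c\<rfloor>)"

lemma endpoint_eq_ray:
  assumes "x $ c = real k"
  shows "endpoint c x = ray c x k"
  using assms by (simp add: endpoint_def)

lemma units_Nats: "x \<in> U \<Longrightarrow> x $ c \<in> \<nat>"
  using units_up up_positionsD(1) by blast

lemma units_natE:
  assumes "x \<in> U"
  obtains k where "x $ c = real k"
  using units_Nats[OF assms, of c] by (auto elim: Nats_cases)

lemma endpoint_up:
  assumes "x \<in> U"
  shows "endpoint c x \<in> up_positions n" "endpoint c x $ c = 0"
proof -
  obtain k where "x $ c = real k"
    by (rule units_natE[OF assms])
  then show "endpoint c x \<in> up_positions n" "endpoint c x $ c = 0"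
    using ray_up[OF assms] ray_level[OF assms] endpoint_eq_ray by auto
qed

lemma inj_on_endpoint: "inj_on (endpoint c) U"
proof
  fix x x' assume *: "x \<in> U" "x' \<in> U" "endpoint c x = endpoint c x'"
  obtain k where "x $ c = real k"
    by (rule units_natE[OF *(1)])
  moreover obtain k' where "x' $ c = real k'"
    by (rule units_natE[OF *(2)])
  ultimately show "x = x'"
    using ray_disjoint[of x x' k c k'] * endpoint_eq_ray by auto
qed

text \<open>There are as many units as positions in the row next to an edge, so every unit segment of the edge
  receives a color.\<close>
lemma endpoint_image: "endpoint c ` U = {z \<in> up_positions n. z $ c = 0}"
proof (rule card_subset_eq)
  show fin: "finite {z \<in> up_positions n. z $ c = 0}"
    using card_row(1)[of n c 0] by simp
  show sub: "endpoint c ` U \<subseteq> {z \<in> up_positions n. z $ c = 0}"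
    using endpoint_up by auto
  have "card (endpoint c ` U) = n"
    using inj_on_endpoint card_units by (simp add: card_image)
  then show "card (endpoint c ` U) = card {z \<in> up_positions n. z $ c = 0}"
    using card_mono[OF fin sub] card_row(2)[of n c 0] by simp
qed

section \<open>Counting colors between the rays\<close>

text \<open>These are the upward triangles resting on the line where coordinate \<open>a\<close> is \<open>h\<close> whose rhombus is cut
  by that line.  The rays in direction \<open>a\<close> miss them, and they are the only places where rays in the
  other directions get across the line towards the vertex \<open>a\<close>.\<close>
definition raised :: "3 \<Rightarrow> real \<Rightarrow> (real ^ 3) set" where
  "raised a h = {y + axis a 1 | y. y \<in> down_positions n \<and> mate y = a \<and> y $ a + 1 = h}"

lemma raisedE:
  assumes "v \<in> raised a h"
  obtains y where "y \<in> down_positions n" "v = y + axis (mate y) 1" "mate y = a" "v $ a = h"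
  using assms by (auto simp: raised_def axis_def)

lemma raised_row: "raised a h \<subseteq> {x \<in> up_positions n. x $ a = h}"
  using down_positions_raise by (auto simp: raised_def)

lemma climb_through_raised:
  assumes "x \<in> U" "a \<noteq> b" "h \<in> \<nat>" "x $ a < h" "h \<le> ray b x k $ a" "real k \<le> x $ b"
  obtains l where "real l \<le> real k" "ray b x l \<in> raised a h"
proof -
  have "\<exists>l\<le>k. ray b x l \<in> raised a h"
    using assms(5-)
  proof (induction k)
    case 0
    then show ?case
      using assms(4) by (simp add: ray_0)
  next
    case (Suc k)
    show ?case
    proof (cases "h \<le> ray b x k $ a")
      case True
      then have "\<exists>l\<le>k. ray b x l \<in> raised a h"
        using Suc by simp
      then show ?thesis
        using le_SucI by blast
    next
      case False
      obtain y where y: "y \<in> down_positions n" "ray b x k = y + axis b 1"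
        "ray b x (Suc k) = y + axis (mate y) 1"
        using ray_cross[OF assms(1) Suc.prems(2)] by metis
      have "y $ a < h"
        using y False assms(2) by (simp add: axis_def)
      then have "y $ a + 1 \<le> h"
        using Nats_less_imp_add1_le down_positionsD(1)[OF y(1)] assms(3) by blast
      moreover have "mate y = a" "h \<le> y $ a + 1"
        using y Suc.prems(1) \<open>y $ a < h\<close> by (auto simp: axis_def split: if_splits)
      ultimately show ?thesis
        using y by (intro exI[of _ "Suc k"]) (auto simp: raised_def)
    qed
  qed
  then show ?thesis
    using that by auto
qed

text \<open>Let \<open>x'\<close> start lower than \<open>x\<close>, that is, farther from the vertex \<open>a\<close>.  To end at least as high as \<open>x\<close>
  on the edge opposite to \<open>b\<close>, its ray must climb across the line through \<open>x\<close> at a raised position, and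
  it has to do so on the side of \<open>x\<close> from which rays in direction \<open>b\<close> come.\<close>
lemma overtaking_through_raised:
  assumes "x \<in> U" "x' \<in> U" "a \<noteq> b" "x' $ a < x $ a"
    and "\<not> endpoint b x' $ a < endpoint b x $ a"
  obtains l where "real l \<le> x' $ b" "ray b x' l \<in> raised a (x $ a)" "x $ b < ray b x' l $ b"
proof -
  obtain k where k: "x $ b = real k"
    by (rule units_natE[OF assms(1)])
  obtain k' where k': "x' $ b = real k'"
    by (rule units_natE[OF assms(2)])
  note k = k k'
  have ends: "endpoint b x = ray b x k" "endpoint b x' = ray b x' k'"
    using endpoint_eq_ray k by auto
  have "x $ a \<le> ray b x' k' $ a"
    using ray_mono[OF assms(1), of k b a] assms k ends by auto
  then obtain l where l: "real l \<le> real k'" "ray b x' l \<in> raised a (x $ a)"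
    using climb_through_raised[OF assms(2,3) units_Nats[OF assms(1)] assms(4), of k'] k by auto
  define v where "v = ray b x' l"
  obtain y where y: "y \<in> down_positions n" "v = y + axis (mate y) 1" "v $ a = x $ a"
    using l(2) v_def by (auto elim: raisedE)
  have v: "v \<in> up_positions n" "v $ b = real k' - real l"
    using ray_up[OF assms(2)] ray_level[OF assms(2)] l(1) k by (auto simp: v_def)
  \<comment> \<open>If \<open>v\<close> were nearer to the edge \<open>b\<close> than \<open>x\<close>, the \<open>b\<close>-ray of \<open>x\<close> would reach the row of \<open>v\<close> at a
    position higher than \<open>v\<close>, and order preservation would carry this to the two endpoints.\<close>
  have "\<not> v $ b < x $ b"
  proof
    assume lt: "v $ b < x $ b"
    define s where "s = k - (k' - l)"
    have s: "k = s + (k' - l)" "k' = l + (k' - l)" "real s \<le> x $ b"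
      using lt v(2) l(1) k unfolding s_def by linarith+
    have "real s = real k - (real k' - real l)"
      using s by linarith
    then have z: "ray b x s \<in> up_positions n" "ray b x s $ b = v $ b"
      using ray_up[OF assms(1) s(3)] ray_level[OF assms(1) s(3)] v(2) k by simp_all
    have "v \<noteq> ray b x s"
      using ray_disjoint[OF assms(2,1), of l b s] s(3) l(1) k assms(4) by (auto simp: v_def)
    then have "v $ a \<noteq> ray b x s $ a"
      using up_positions_eqI[OF v(1) z(1) assms(3)] z(2) by auto
    moreover have "x $ a \<le> ray b x s $ a"
      using ray_mono[OF assms(1) s(3) assms(3)] .
    ultimately have "ray b x' l $ a < ray b x s $ a"
      using y(3) by (simp add: v_def)
    then have "ray b x' (l + (k' - l)) $ a < ray b x (s + (k' - l)) $ a"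
    proof (rule ray_order[OF assms(2,1,3), rotated])
      show "ray b x' l $ b = ray b x s $ b"
        using z(2) by (simp add: v_def)
      show "real (l + (k' - l)) \<le> x' $ b" "real (s + (k' - l)) \<le> x $ b"
        using s(1,2) k by auto
    qed
    then show False
      using assms(5) ends s(1,2) by simp
  qed
  moreover have "v $ b \<noteq> x $ b"
  proof
    assume "v $ b = x $ b"
    then have "v = x"
      using up_positions_eqI[OF v(1) _ assms(3)] y(3) assms(1) units_up by blast
    then show False
      using y units_unmatched assms(1) by blast
  qed
  ultimately show ?thesis
    using that[of l] l k by (simp add: v_def)
qed

text \<open>Disjointness of rays allows each raised position to serve only one overtaking unit.\<close>
lemma card_overtaking:
  assumes "x \<in> U" "a \<noteq> b"
  shows "card {x' \<in> U. x' $ a < x $ a \<and> \<not> endpoint b x' $ a < endpoint b x $ a}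
    \<le> card {v \<in> raised a (x $ a). x $ b < v $ b}" (is "card ?O \<le> card ?V")
proof -
  have "\<forall>x'\<in>?O. \<exists>l. real l \<le> x' $ b \<and> ray b x' l \<in> ?V"
  proof
    fix x' assume "x' \<in> ?O"
    then obtain l where "real l \<le> x' $ b" "ray b x' l \<in> raised a (x $ a)" "x $ b < ray b x' l $ b"
      using overtaking_through_raised[OF assms(1) _ assms(2)] by blast
    then show "\<exists>l. real l \<le> x' $ b \<and> ray b x' l \<in> ?V"
      by blast
  qed
  then obtain f where f: "\<forall>x'\<in>?O. real (f x') \<le> x' $ b \<and> ray b x' (f x') \<in> ?V"
    by (rule bchoice[THEN exE])
  show ?thesis
  proof (rule card_inj_on_le)
    show "inj_on (\<lambda>x'. ray b x' (f x')) ?O"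
      using f by (auto simp: inj_on_def intro: ray_disjoint)
    show "(\<lambda>x'. ray b x' (f x')) ` ?O \<subseteq> ?V"
      using f by blast
    obtain h where "x $ a = real h"
      by (rule units_natE[OF assms(1)])
    then show "finite ?V"
      using finite_subset[OF raised_row] card_row(1)[of n a h] by auto
  qed
qed

text \<open>The row on the line at height \<open>h\<close> has \<open>n - h\<close> positions, and the raised ones among them are lost
  for the units above the line.  So there are at most \<open>n - h - card (raised a h)\<close> units above.\<close>
lemma card_units_below:
  assumes "x \<in> U" "x $ a = real h"
  shows "h + card (raised a (real h)) \<le> card {x' \<in> U. x' $ a < x $ a}"
proof -
  let ?row = "{z \<in> up_positions n. z $ a = real h}" and ?A = "{x' \<in> U. real h \<le> x' $ a}"
  define f where "f x' = ray a x' (nat \<lfloor>x' $ a\<rfloor> - h)" for x'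
  have f: "real (nat \<lfloor>x' $ a\<rfloor> - h) \<le> x' $ a \<and> f x' \<in> ?row - raised a (real h)" if "x' \<in> ?A" for x'
  proof -
    have U: "x' \<in> U"
      using that by simp
    obtain k where k: "x' $ a = real k"
      by (rule units_natE[OF U])
    then have le: "real (k - h) \<le> x' $ a" "h \<le> k"
      using that by auto
    have eq: "f x' = ray a x' (k - h)"
      using k by (simp add: f_def)
    have "f x' \<in> ?row"
      using ray_up[OF U le(1)] ray_level[OF U le(1)] eq k le by (simp add: of_nat_diff)
    moreover have "f x' \<notin> raised a (real h)"
      using ray_active[OF U le(1)] eq by (metis raisedE)
    ultimately show ?thesis
      using le k by simp
  qed
  have fin: "finite ?row"
    by (rule card_row(1))
  \<comment> \<open>The \<open>a\<close>-rays of the units above the line cross it, or start on it, at different positions, and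
    none of these is raised, because a ray in direction \<open>a\<close> is never at a position matched in
    direction \<open>a\<close>.\<close>
  have "card ?A \<le> card (?row - raised a (real h))"
  proof (rule card_inj_on_le)
    show "inj_on f ?A"
    proof
      fix x1 x2 assume *: "x1 \<in> ?A" "x2 \<in> ?A" "f x1 = f x2"
      then show "x1 = x2"
        using f[OF *(1)] f[OF *(2)] unfolding f_def by (blast intro: ray_disjoint)
    qed
  qed (use f fin in auto)
  also have "\<dots> = card ?row - card (raised a (real h))"
    by (rule card_Diff_subset[OF finite_subset[OF raised_row fin] raised_row])
  also have "\<dots> \<le> n - h - card (raised a (real h))"
    using card_row(2)[of n a h] by simp
  finally have "card ?A \<le> n - h - card (raised a (real h))" .
  moreover have "card ?A > 0"
    using assms finite_units by (auto simp: card_gt_0_iff)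
  moreover have "card U = card {x' \<in> U. x' $ a < x $ a} + card ?A"
    using finite_units assms(2)
    by (subst card_Un_disjoint[symmetric]) (auto intro!: arg_cong[of _ _ card])
  ultimately show ?thesis
    using card_units by linarith
qed

definition farther :: "3 \<Rightarrow> real ^ 3 \<Rightarrow> (real ^ 3) set" where
  "farther a x = {x' \<in> U. \<forall>b. b \<noteq> a \<longrightarrow> endpoint b x' $ a < endpoint b x $ a}"

lemma coordinate_le_card_farther:
  assumes "x \<in> U"
  shows "x $ a \<le> real (card (farther a x))"
proof -
  obtain b c where bc: "b \<noteq> a" "c \<noteq> a" "b \<noteq> c"
    by (rule other_directions)
  obtain h where h: "x $ a = real h"
    by (rule units_natE[OF assms])
  define V where "V = raised a (real h)"
  let ?below = "{x' \<in> U. x' $ a < x $ a}"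
  let ?O = "\<lambda>b. {x' \<in> U. x' $ a < x $ a \<and> \<not> endpoint b x' $ a < endpoint b x $ a}"
  have finV: "finite V"
    unfolding V_def by (rule finite_subset[OF raised_row card_row(1)])
  \<comment> \<open>A unit below the line fails to be farther only if it overtakes along \<open>b\<close> or along \<open>c\<close>.  The
    raised positions used for the two failures lie on opposite sides of \<open>x\<close>, so there are at most
    \<open>card V\<close> failures, which does not exceed \<open>card ?below - h\<close>.\<close>
  have "?below \<subseteq> farther a x \<union> (?O b \<union> ?O c)"
    using bc three_directions(1)[of a b c "\<lambda>d. d \<noteq> a \<longrightarrow> endpoint d _ $ a < endpoint d x $ a"]
    by (auto simp: farther_def)
  then have "card ?below \<le> card (farther a x \<union> (?O b \<union> ?O c))"
    using finite_units by (intro card_mono) (auto simp: farther_def)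
  also have "\<dots> \<le> card (farther a x) + (card (?O b) + card (?O c))"
    by (meson card_Un_le add_left_mono order_trans)
  also have "card (?O b) + card (?O c) \<le> card {v \<in> V. x $ b < v $ b} + card {v \<in> V. x $ c < v $ c}"
    using card_overtaking[OF assms, of a] bc h by (intro add_mono) (auto simp: V_def)
  also have "\<dots> = card ({v \<in> V. x $ b < v $ b} \<union> {v \<in> V. x $ c < v $ c})"
  proof (rule card_Un_disjoint[symmetric])
    have "\<not> (x $ b < v $ b \<and> x $ c < v $ c)" if "v \<in> V" for v
    proof -
      have v: "v \<in> up_positions n" "v $ a = x $ a"
        using that raised_row h by (auto simp: V_def)
      show ?thesis
        using up_positionsD(2)[OF v(1)] up_positionsD(2)[of x n] assms units_up v(2) bc
        by (auto simp: three_directions(2)[of a b c])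
    qed
    then show "{v \<in> V. x $ b < v $ b} \<inter> {v \<in> V. x $ c < v $ c} = {}"
      by blast
  qed (use finV in auto)
  also have "\<dots> \<le> card V"
    using finV by (intro card_mono) auto
  finally have "card ?below \<le> card (farther a x) + card V"
    by simp
  then have "h \<le> card (farther a x)"
    using card_units_below[OF assms h] by (simp add: V_def)
  then show ?thesis
    using h by simp
qed

text \<open>This is the key to both halves of the result: the position of a unit is read off from the order
  in which the colors arrive on the edges, by counting the colors that are farther from a vertex on
  both edges at that vertex.\<close>
theorem coordinate_eq_card_farther:
  assumes "x \<in> U"
  shows "x $ a = real (card (farther a x))"
proof -
  obtain b c where bc: "b \<noteq> a" "c \<noteq> a" "b \<noteq> c"
    by (rule other_directions)
  \<comment> \<open>On the edge joining the vertices \<open>d\<close> and \<open>d'\<close>, being farther from one means being nearer to the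
    other.\<close>
  have disj: "farther d x \<inter> farther d' x = {}" if dd: "d \<noteq> d'" for d d'
  proof -
    obtain e where e: "e \<noteq> d" "e \<noteq> d'"
      using third_direction[OF dd] .
    have False if "x' \<in> farther d x" "x' \<in> farther d' x" for x'
    proof -
      have x': "x' \<in> U"
        using that by (simp add: farther_def)
      show False
        using that e dd up_positionsD(2)[OF endpoint_up(1)[OF x', of e]]
          up_positionsD(2)[OF endpoint_up(1)[OF assms, of e]]
          endpoint_up(2)[OF x', of e] endpoint_up(2)[OF assms, of e]
        by (auto simp: farther_def three_directions(2)[of d d' e] dest!: spec[of _ e])
    qed
    then show ?thesis
      by blast
  qed
  have fin: "finite (farther d x)" for d
    using finite_units by (simp add: farther_def)
  \<comment> \<open>The three lower bounds sum to \<open>n - 1\<close>, which is also the number of units other than \<open>x\<close>; so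
    none of them can be strict.\<close>
  have "farther a x \<union> (farther b x \<union> farther c x) \<subseteq> U - {x}"
    using bc by (auto simp: farther_def)
  then have "card (farther a x \<union> (farther b x \<union> farther c x)) \<le> n - 1"
    using assms finite_units card_units card_mono[of "U - {x}"] by auto
  then have "card (farther a x) + (card (farther b x) + card (farther c x)) \<le> n - 1"
    using bc fin disj by (subst (asm) card_Un_disjoint, auto)+
  moreover have "n \<ge> 1"
    using assms card_units finite_units by (metis One_nat_def Suc_leI card_gt_0_iff empty_iff)
  moreover have "x $ a + (x $ b + x $ c) = real n - 1"
    using up_positionsD(2)[of x n] assms units_up bc by (auto simp: three_directions(2)[of a b c])
  ultimately show ?thesis
    using coordinate_le_card_farther[OF assms, of a] coordinate_le_card_farther[OF assms, of b]
      coordinate_le_card_farther[OF assms, of c] by linarith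
qed

end

section \<open>Unit triangles in coordinates and their sides\<close>

lemma mem_up_triangle:
  "v \<in> up_triangle x \<longleftrightarrow> (\<forall>a. x $ a \<le> v $ a) \<and> (\<Sum>a\<in>UNIV. v $ a) = (\<Sum>a\<in>UNIV. x $ a) + 1"
proof -
  have hull: "convex hull range (\<lambda>a::3. axis a (1::real)) =
      {w. (\<forall>a. 0 \<le> w $ a) \<and> (\<Sum>a\<in>UNIV. w $ a) = 1}"
  proof -
    have range: "range (\<lambda>a::3. axis a (1::real)) = {axis 1 1, axis 2 1, axis 3 1}"
      by (auto simp: UNIV_3)
    show ?thesis
      unfolding range convex_hull_3
      by (auto simp: vec_eq_iff forall_3 sum_3 axis_def intro!: exI[of _ "_ $ 1"] exI[of _ "_ $ 2"] exI[of _ "_ $ 3"])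
  qed
  have "v \<in> up_triangle x \<longleftrightarrow> v - x \<in> convex hull range (\<lambda>a::3. axis a (1::real))"
    by (auto simp: up_triangle_def image_iff algebra_simps) (metis add.commute diff_add_cancel)
  then show ?thesis
    unfolding hull by (auto simp: sum_subtractf)
qed

lemma mem_down_triangle:
  "v \<in> down_triangle y \<longleftrightarrow> (\<forall>a. v $ a \<le> y $ a + 1) \<and> (\<Sum>a\<in>UNIV. v $ a) = (\<Sum>a\<in>UNIV. y $ a) + 2"
proof -
  have hull: "convex hull range (\<lambda>a::3. 1 - axis a (1::real)) =
      {w. (\<forall>a. w $ a \<le> 1) \<and> (\<Sum>a\<in>UNIV. w $ a) = 2}"
  proof -
    have range: "range (\<lambda>a::3. 1 - axis a (1::real)) = {1 - axis 1 1, 1 - axis 2 1, 1 - axis 3 1}"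
      by (auto simp: UNIV_3)
    show ?thesis
    proof (intro subset_antisym subsetI)
      fix w :: "real ^ 3" assume w: "w \<in> {w. (\<forall>a. w $ a \<le> 1) \<and> (\<Sum>a\<in>UNIV. w $ a) = 2}"
      then have "w = (1 - w $ 1) *\<^sub>R (1 - axis 1 1) + (1 - w $ 2) *\<^sub>R (1 - axis 2 1)
          + (1 - w $ 3) *\<^sub>R (1 - axis 3 1)"
        by (auto simp: vec_eq_iff forall_3 sum_3 axis_def)
      moreover have "0 \<le> 1 - w $ 1" "0 \<le> 1 - w $ 2" "0 \<le> 1 - w $ 3"
          "1 - w $ 1 + (1 - w $ 2) + (1 - w $ 3) = 1"
        using w by (auto simp: sum_3)
      ultimately show "w \<in> convex hull range (\<lambda>a::3. 1 - axis a (1::real))"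
        unfolding range convex_hull_3 by blast
    next
      fix w assume "w \<in> convex hull range (\<lambda>a::3. 1 - axis a (1::real))"
      then show "w \<in> {w. (\<forall>a. w $ a \<le> 1) \<and> (\<Sum>a\<in>UNIV. w $ a) = 2}"
        unfolding range convex_hull_3 by (auto simp: forall_3 sum_3 axis_def)
    qed
  qed
  have "v \<in> down_triangle y \<longleftrightarrow> v - y \<in> convex hull range (\<lambda>a::3. 1 - axis a (1::real))"
    by (auto simp: down_triangle_def image_iff algebra_simps) (metis add.commute diff_add_cancel)
  then show ?thesis
    unfolding hull by (auto simp: sum_subtractf algebra_simps)
qed

text \<open>Every side of a unit triangle, upward or downward, is a side of exactly one upward unit triangle.  So
  the pair of a direction and a position is a unique name for it.\<close>
definition up_side :: "3 \<Rightarrow> real ^ 3 \<Rightarrow> (real ^ 3) set" where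
  "up_side c z = {v \<in> up_triangle z. v $ c = z $ c}"

lemma up_side_segment:
  assumes "a \<noteq> b" "a \<noteq> c" "b \<noteq> c"
  shows "up_side c z = closed_segment (z + axis a 1) (z + axis b 1)"
  using assms
  apply (auto simp: up_side_def mem_up_triangle in_segment vec_eq_iff
      three_directions(1)[of a b c] three_directions(2)[of a b c] axis_def algebra_simps)
  subgoal for v
    by (rule exI[of _ "v $ b - z $ b"]) auto
  done

lemma up_side_inject:
  assumes "up_side c z = up_side c' z'"
  shows "c = c'" "z = z'"
proof -
  have le: "z' $ d \<le> z $ d" if eq: "up_side c z = up_side c' z'" for c c' z z' d
  proof -
    obtain a b where ab: "a \<noteq> c" "b \<noteq> c" "a \<noteq> b"
      by (rule other_directions)
    then have "z + axis a 1 \<in> up_side c z" "z + axis b 1 \<in> up_side c z"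
      by (auto simp: up_side_segment[of a b c])
    then have "z' $ d \<le> (z + axis a 1) $ d" "z' $ d \<le> (z + axis b 1) $ d"
      unfolding eq by (auto simp: up_side_def mem_up_triangle)
    then show ?thesis
      using ab by (auto simp: axis_def split: if_splits)
  qed
  show z: "z = z'"
    using le[OF assms] le[OF assms[symmetric]] by (auto simp: vec_eq_iff intro: antisym)
  show "c = c'"
  proof (rule ccontr)
    assume ne: "c \<noteq> c'"
    obtain b where b: "b \<noteq> c" "b \<noteq> c'"
      using third_direction[OF ne] .
    have "z + axis c' 1 \<in> up_side c z"
      using ne b by (auto simp: up_side_segment[of c' b c])
    then have "z + axis c' 1 \<in> up_side c' z"
      using assms z by simp
    then show False
      by (simp add: up_side_def)
  qed
qed

lemma translate_up_side: "(+) d ` up_side c z = up_side c (z + d)"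
proof -
  obtain a b where "a \<noteq> c" "b \<noteq> c" "a \<noteq> b"
    by (rule other_directions)
  then show ?thesis
    using closed_segment_translation[of d "z + axis a 1" "z + axis b 1"]
    by (simp add: up_side_segment[of a b c] algebra_simps)
qed

lemma aff_dim_up_side: "aff_dim (up_side c z) = 1"
proof -
  obtain a b where ab: "a \<noteq> c" "b \<noteq> c" "a \<noteq> b"
    by (rule other_directions)
  then have "z + axis a 1 \<noteq> z + axis b (1::real)"
    by (simp add: axis_eq_axis)
  then show ?thesis
    using ab by (simp add: up_side_segment[of a b c] segment_convex_hull aff_dim_convex_hull aff_dim_2)
qed

text \<open>A face of a simplex is spanned by some of its vertices; to have dimension 1 it has to omit
  exactly one of the three.\<close>
lemma edge_of_triangle_iff:
  fixes f :: "3 \<Rightarrow> real ^ 3"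
  assumes inj: "inj f" and indep: "\<not> affine_dependent (range f)"
  shows "s edge_of convex hull (range f) \<longleftrightarrow> (\<exists>a. s = convex hull (f ` (- {a})))"
proof
  assume "s edge_of convex hull (range f)"
  then obtain C where C: "C \<subseteq> range f" "s = convex hull C" "aff_dim s = 1"
    using face_of_convex_hull_affine_independent[OF indep] by (auto simp: edge_of_def)
  have "\<not> affine_dependent C"
    using C(1) affine_independent_subset indep by blast
  then have card: "card C = 2"
    using C aff_dim_affine_independent[of C] by (simp add: aff_dim_convex_hull)
  have "card (range f - C) = 1"
    using C(1) card inj by (subst card_Diff_subset) (auto simp: card_image finite_subset[OF C(1)])
  then obtain q where q: "range f - C = {q}"
    by (auto simp: card_1_singleton_iff)
  then obtain a where "q = f a"
    by blast
  then have "C = f ` (- {a})"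
    using q C(1) inj by (auto dest: injD)
  then show "\<exists>a. s = convex hull (f ` (- {a}))"
    using C by blast
next
  assume "\<exists>a. s = convex hull (f ` (- {a}))"
  then obtain a where s: "s = convex hull (f ` (- {a}))"
    by blast
  have "card (f ` (- {a})) = 2"
    using inj by (subst card_image) (auto simp: Compl_eq_Diff_UNIV card_Diff_subset intro: inj_on_subset)
  moreover have "\<not> affine_dependent (f ` (- {a}))"
    by (rule affine_independent_subset[OF indep]) blast
  ultimately have "aff_dim s = 1"
    using aff_dim_affine_independent[of "f ` (- {a})"] s by (simp add: aff_dim_convex_hull)
  moreover have "s face_of convex hull (range f)"
    unfolding face_of_convex_hull_affine_independent[OF indep]
    using s by (intro exI[of _ "f ` (- {a})"]) auto
  ultimately show "s edge_of convex hull (range f)"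
    by (simp add: edge_of_def)
qed

lemma up_triangle_hull: "up_triangle x = convex hull (range (\<lambda>a. x + axis a 1))"
  by (simp add: up_triangle_def convex_hull_translation[symmetric] image_image)

lemma down_triangle_hull: "down_triangle y = convex hull (range (\<lambda>a. y + (1 - axis a 1)))"
  by (simp add: down_triangle_def convex_hull_translation[symmetric] image_image)

lemma independent_axes: "independent (range (\<lambda>a::3. axis a (1::real)))"
  by (rule independent_mono[OF independent_Basis]) (auto simp: Basis_vec_def)

lemma axes_hull_image:
  assumes "a \<noteq> b" "a \<noteq> c" "b \<noteq> c"
  shows "f ` (- {c :: 3}) = {f a, f b}"
proof -
  have "- {c} = {a, b}"
    using three_directions(1)[of a b c "\<lambda>d. d \<in> - {c} \<longleftrightarrow> d \<in> {a, b}"] assms by blast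
  then show ?thesis
    by simp
qed

lemma edge_of_up_triangle_iff: "s edge_of up_triangle x \<longleftrightarrow> (\<exists>c. s = up_side c x)"
proof -
  have "\<not> affine_dependent ((+) x ` range (\<lambda>a::3. axis a (1::real)))"
    using independent_axes affine_dependent_imp_dependent affine_dependent_translation_eq by blast
  then have indep: "\<not> affine_dependent (range (\<lambda>a. x + axis a 1))"
    by (simp add: image_image)
  have inj: "inj (\<lambda>a. x + axis a (1::real))"
    by (auto simp: inj_def axis_eq_axis)
  have "convex hull ((\<lambda>a. x + axis a 1) ` (- {c})) = up_side c x" for c
  proof -
    obtain a b where ab: "a \<noteq> c" "b \<noteq> c" "a \<noteq> b"
      by (rule other_directions)
    then show ?thesis
      by (simp add: axes_hull_image[of a b c] up_side_segment[of a b c] segment_convex_hull)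
  qed
  then show ?thesis
    unfolding up_triangle_hull edge_of_triangle_iff[OF inj indep] by simp
qed

lemma edge_of_down_triangle_iff: "s edge_of down_triangle y \<longleftrightarrow> (\<exists>c. s = up_side c (y + axis c 1))"
proof -
  have "independent (uminus ` range (\<lambda>a::3. axis a (1::real)))"
    by (rule linear_independent_injective_image[OF linear_uminus independent_axes]) simp
  then have "\<not> affine_dependent (uminus ` range (\<lambda>a::3. axis a (1::real)))"
    using affine_dependent_imp_dependent by blast
  then have "\<not> affine_dependent ((+) (y + 1) ` uminus ` range (\<lambda>a::3. axis a (1::real)))"
    using affine_dependent_translation_eq by blast
  then have indep: "\<not> affine_dependent (range (\<lambda>a. y + (1 - axis a 1)))"
    by (simp add: image_image algebra_simps)
  have inj: "inj (\<lambda>a. y + (1 - axis a (1::real)))"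
    by (auto simp: inj_def axis_eq_axis)
  have "convex hull ((\<lambda>a. y + (1 - axis a 1)) ` (- {c})) = up_side c (y + axis c 1)" for c
  proof -
    obtain a b where ab: "a \<noteq> c" "b \<noteq> c" "a \<noteq> b"
      by (rule other_directions)
    then have "y + (1 - axis a 1) = y + axis c 1 + axis b 1" "y + (1 - axis b 1) = y + axis c 1 + axis a 1"
      by (auto simp: vec_eq_iff three_directions(1)[of a b c] axis_def)
    then show ?thesis
      using ab by (simp add: axes_hull_image[of a b c] up_side_segment[of a b c] segment_convex_hull
          insert_commute add.assoc)
  qed
  then show ?thesis
    unfolding down_triangle_hull edge_of_triangle_iff[OF inj indep] by simp
qed

section \<open>Unit rhombi and their sides\<close>

definition rhombus :: "real ^ 3 \<Rightarrow> 3 \<Rightarrow> (real ^ 3) set" where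
  "rhombus y d = up_triangle (y + axis d 1) \<union> down_triangle y"

definition up_center :: "real ^ 3 \<Rightarrow> real ^ 3" where
  "up_center x = (\<chi> a. x $ a + 1 / 3)"

definition down_center :: "real ^ 3 \<Rightarrow> real ^ 3" where
  "down_center y = (\<chi> a. y $ a + 2 / 3)"

lemma up_center_in: "up_center x \<in> up_triangle x"
  by (simp add: mem_up_triangle up_center_def sum_3)

lemma down_center_in: "down_center y \<in> down_triangle y"
  by (simp add: mem_down_triangle down_center_def sum_3)

lemma positions_le_imp_eq:
  fixes x x' :: "real ^ 3"
  assumes "\<And>a. x $ a \<le> x' $ a" "(\<Sum>a\<in>UNIV. x' $ a) \<le> (\<Sum>a\<in>UNIV. x $ a)"
  shows "x = x'"
  using assms(1)[of 1] assms(1)[of 2] assms(1)[of 3] assms(2)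
  by (simp add: vec_eq_iff forall_3 sum_3)

lemma Nats_less_1_imp_le:
  fixes s t :: real
  assumes "s \<in> \<nat>" "t \<in> \<nat>" "s < t + 1"
  shows "s \<le> t"
  using assms by (auto elim!: Nats_cases)

lemma up_center_in_up_triangle:
  assumes "x \<in> up_positions n" "x' \<in> up_positions n" "up_center x \<in> up_triangle x'"
  shows "x' = x"
proof (rule positions_le_imp_eq)
  show "x' $ a \<le> x $ a" for a
    using assms by (intro Nats_less_1_imp_le up_positionsD(1)) (auto simp: mem_up_triangle up_center_def dest!: spec[of _ a])
qed (use assms up_positionsD(2) in auto)

lemma up_center_not_in_down_triangle:
  assumes "x \<in> up_positions n" "y \<in> down_positions n"
  shows "up_center x \<notin> down_triangle y"
proof
  assume "up_center x \<in> down_triangle y"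
  then have "x $ a \<le> y $ a" for a
    using assms by (intro Nats_less_1_imp_le up_positionsD(1) down_positionsD(1)) (auto simp: mem_down_triangle up_center_def dest!: spec[of _ a])
  then show False
    using positions_le_imp_eq[of x y] up_positionsD(2)[OF assms(1)] down_positionsD(2)[OF assms(2)] by auto
qed

lemma down_center_not_in_up_triangle:
  assumes "x \<in> up_positions n" "y \<in> down_positions n"
  shows "down_center y \<notin> up_triangle x"
proof
  assume "down_center y \<in> up_triangle x"
  then have "x $ a \<le> y $ a" for a
    using assms by (intro Nats_less_1_imp_le up_positionsD(1) down_positionsD(1)) (auto simp: mem_up_triangle down_center_def dest!: spec[of _ a])
  then show False
    using positions_le_imp_eq[of x y] up_positionsD(2)[OF assms(1)] down_positionsD(2)[OF assms(2)] by auto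
qed

lemma down_center_in_down_triangle:
  assumes "y \<in> down_positions n" "y' \<in> down_positions n" "down_center y \<in> down_triangle y'"
  shows "y' = y"
proof (rule positions_le_imp_eq[symmetric])
  show "y $ a \<le> y' $ a" for a
    using assms by (intro Nats_less_1_imp_le down_positionsD(1)) (auto simp: mem_down_triangle down_center_def dest!: spec[of _ a])
qed (use assms down_positionsD(2) in auto)

lemma unit_rhombi_iff: "R \<in> unit_rhombi n \<longleftrightarrow> (\<exists>y\<in>down_positions n. \<exists>d. R = rhombus y d)"
proof
  assume "R \<in> unit_rhombi n"
  then obtain P Q s where *: "R = P \<union> Q" "P \<noteq> Q" "s edge_of P" "s edge_of Q"
    and PQ: "P \<in> unit_triangles n" "Q \<in> unit_triangles n"
    by (auto simp: unit_rhombi_def)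
  have kinds: "(\<exists>x c. S = up_triangle x \<and> s = up_side c x) \<or>
      (\<exists>y\<in>down_positions n. \<exists>c. S = down_triangle y \<and> s = up_side c (y + axis c 1))"
    if S: "S \<in> unit_triangles n" "s edge_of S" for S
  proof -
    from S(1) consider x where "S = up_triangle x"
      | y where "y \<in> down_positions n" "S = down_triangle y"
      unfolding unit_triangles_def up_triangles_def by blast
    then show ?thesis
      using S(2) by cases (simp_all only: edge_of_up_triangle_iff edge_of_down_triangle_iff, blast+)
  qed
  from kinds[OF PQ(1) *(3)] kinds[OF PQ(2) *(4)]
  consider x x' c c' where "P = up_triangle x" "Q = up_triangle x'"
      "s = up_side c x" "s = up_side c' x'"
    | x y c c' where "y \<in> down_positions n" "P \<union> Q = up_triangle x \<union> down_triangle y"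
      "s = up_side c x" "s = up_side c' (y + axis c' 1)"
    | y y' c c' where "P = down_triangle y" "Q = down_triangle y'"
      "s = up_side c (y + axis c 1)" "s = up_side c' (y' + axis c' 1)"
    by (smt (verit, best) Un_commute)
  then show "\<exists>y\<in>down_positions n. \<exists>d. R = rhombus y d"
  proof cases
    case 1
    then show ?thesis
      using *(2) up_side_inject(2)[of c x c' x'] by simp
  next
    case 2
    then show ?thesis
      using *(1) up_side_inject(2)[of c x c' "y + axis c' 1"] unfolding rhombus_def by auto
  next
    case 3
    then show ?thesis
      using *(2) up_side_inject[of c "y + axis c 1" c' "y' + axis c' 1"] by simp
  qed
next
  assume "\<exists>y\<in>down_positions n. \<exists>d. R = rhombus y d"
  then obtain y d where y: "y \<in> down_positions n" "R = rhombus y d"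
    by blast
  let ?P = "up_triangle (y + axis d 1)" and ?Q = "down_triangle y"
  have "?P \<in> unit_triangles n" "?Q \<in> unit_triangles n"
    using y down_positions_raise by (auto simp: unit_triangles_def up_triangles_def)
  moreover have "?P \<noteq> ?Q"
    using down_center_in down_center_not_in_up_triangle[OF down_positions_raise y(1)] y by metis
  moreover have "up_side d (y + axis d 1) edge_of ?P" "up_side d (y + axis d 1) edge_of ?Q"
    by (auto simp: edge_of_up_triangle_iff edge_of_down_triangle_iff)
  ultimately show "R \<in> unit_rhombi n"
    using y unfolding unit_rhombi_def rhombus_def by blast
qed

text \<open>A union of two triangles is not visibly convex, so this is proved from the definition of a face:
  when a convex combination attains an extremal value of a coordinate, its end points attain it too.\<close>
lemma face_of_extremal_coordinate:
  fixes R :: "(real ^ 'n) set"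
  assumes "convex {v \<in> R. v $ c = t}" "(\<forall>v\<in>R. t \<le> v $ c) \<or> (\<forall>v\<in>R. v $ c \<le> t)"
  shows "{v \<in> R. v $ c = t} face_of R"
  unfolding face_of_def
proof (intro conjI ballI impI)
  fix p q v assume *: "p \<in> R" "q \<in> R" "v \<in> {v \<in> R. v $ c = t}" "v \<in> open_segment p q"
  then obtain u where u: "0 < u" "u < 1" "v = (1 - u) *\<^sub>R p + u *\<^sub>R q"
    by (auto simp: in_segment)
  have "(1 - u) * (p $ c - t) + u * (q $ c - t) = 0"
    using * u by (simp add: algebra_simps)
  moreover have "0 \<le> (1 - u) * (p $ c - t) \<and> 0 \<le> u * (q $ c - t) \<or>
      (1 - u) * (p $ c - t) \<le> 0 \<and> u * (q $ c - t) \<le> 0"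
    using assms(2) * u by (auto intro!: mult_nonneg_nonneg mult_nonneg_nonpos)
  ultimately have "(1 - u) * (p $ c - t) = 0" "u * (q $ c - t) = 0"
    by linarith+
  then show "p \<in> {v \<in> R. v $ c = t}" "q \<in> {v \<in> R. v $ c = t}"
    using u * by auto
qed (use assms(1) in auto)

lemma up_side_edge_of_rhombus:
  assumes "c \<noteq> d"
  shows "up_side c (y + axis c 1) edge_of rhombus y d" "up_side c (y + axis d 1) edge_of rhombus y d"
proof -
  obtain k where k: "k \<noteq> c" "k \<noteq> d"
    using third_direction[OF assms] .
  have convex: "convex (up_side c z)" for z
    using assms k by (simp add: up_side_segment[of d k c])
  note coords = mem_up_triangle mem_down_triangle rhombus_def up_side_def axis_def
    three_directions(1)[OF assms k[symmetric]] three_directions(2)[OF assms k[symmetric]]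
  have top: "up_side c (y + axis c 1) = {v \<in> rhombus y d. v $ c = y $ c + 1}"
    using assms k by (auto simp: coords)
  have "\<forall>v\<in>rhombus y d. v $ c \<le> y $ c + 1"
    using assms k by (auto simp: coords)
  then show "up_side c (y + axis c 1) edge_of rhombus y d"
    using face_of_extremal_coordinate[of "rhombus y d" c "y $ c + 1"] convex[of "y + axis c 1"]
      aff_dim_up_side[of c "y + axis c 1"] by (simp add: edge_of_def top)
  have bottom: "up_side c (y + axis d 1) = {v \<in> rhombus y d. v $ c = y $ c}"
    using assms k by (auto simp: coords)
  have "\<forall>v\<in>rhombus y d. y $ c \<le> v $ c"
    using assms k by (auto simp: coords)
  then show "up_side c (y + axis d 1) edge_of rhombus y d"
    using face_of_extremal_coordinate[of "rhombus y d" c "y $ c"] convex[of "y + axis d 1"]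
      aff_dim_up_side[of c "y + axis d 1"] by (simp add: edge_of_def bottom)
qed

text \<open>It suffices to treat translates of sides of upward triangles, at an arbitrary point \<open>z\<close>, because
  the opposite side in a crossing is by definition a translate of such a side.\<close>
lemma rhombus_edgeD:
  assumes "up_side c z edge_of rhombus y d"
  shows "c \<noteq> d" "z = y + axis c 1 \<or> z = y + axis d 1"
proof -
  obtain a b where ab: "a \<noteq> c" "b \<noteq> c" "a \<noteq> b"
    by (rule other_directions)
  have face: "up_side c z face_of rhombus y d"
    using assms by (simp add: edge_of_def)
  have vertex: "\<exists>k. z + axis e 1 = y + axis d 1 + axis k 1 \<or> z + axis e 1 = y + (1 - axis k 1)"
    if "e = a \<or> e = b" for e
  proof -
    have "(z + axis e 1) extreme_point_of up_side c z"
      using ab that by (auto simp: up_side_segment[of a b c] extreme_point_of_segment)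
    then have "{z + axis e 1} face_of rhombus y d"
      using face face_of_singleton face_of_trans by blast
    then have "(z + axis e 1) extreme_point_of up_triangle (y + axis d 1) \<or>
      (z + axis e 1) extreme_point_of down_triangle y"
      using face_of_subset[of "{z + axis e 1}" "rhombus y d"] face_of_imp_subset
      unfolding face_of_singleton[symmetric] rhombus_def by blast
    then show ?thesis
      unfolding up_triangle_hull down_triangle_hull by (auto dest!: extreme_point_of_convex_hull)
  qed
  obtain i where i: "z + axis a 1 = y + axis d 1 + axis i 1 \<or> z + axis a 1 = y + (1 - axis i 1)"
    using vertex by blast
  obtain j where j: "z + axis b 1 = y + axis d 1 + axis j 1 \<or> z + axis b 1 = y + (1 - axis j 1)"
    using vertex by blast
  \<comment> \<open>Both endpoints of the side are vertices of the rhombus, and they differ by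
    \<open>axis a 1 - axis b 1\<close>; the few pairs of vertices with this difference are checked one by one.\<close>
  have cases: "(d = a \<or> d = b \<or> d = c) \<and> (i = a \<or> i = b \<or> i = c) \<and> (j = a \<or> j = b \<or> j = c)"
    using three_directions(1)[of a b c "\<lambda>d. d = a \<or> d = b \<or> d = c"] ab by blast
  show disj: "z = y + axis c 1 \<or> z = y + axis d 1"
    using cases i j ab
    by (elim disjE conjE; hypsubst)
      (simp_all add: vec_eq_iff three_directions(1)[of a b c] axis_def)
  show "c \<noteq> d"
  proof
    assume cd: "c = d"
    then have z: "z = y + axis d 1"
      using disj by simp
    \<comment> \<open>Then the side is the diagonal along which the two triangles are glued, and it crosses the other
      diagonal, from \<open>p\<close> to \<open>q\<close>, at its midpoint; a face cannot do that.\<close>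
    define p q where "p = y + axis d 1 + axis d 1" and "q = y + (1 - axis d 1)"
    have pq: "p \<in> rhombus y d" "q \<in> rhombus y d" "p \<noteq> q" "p \<notin> up_side c z" "midpoint p q \<in> up_side c z"
      using ab cd by (auto simp: p_def q_def z rhombus_def up_side_def mem_up_triangle mem_down_triangle
          vec_eq_iff midpoint_def three_directions(1)[of a b c] three_directions(2)[of a b c] axis_def
          field_simps)
    then have "midpoint p q \<in> open_segment p q"
      by simp
    then show False
      using face pq unfolding face_of_def by blast
  qed
qed

section \<open>The matching of a tiling\<close>

text \<open>The centers of the unit triangles serve to compare tiles.  A center lies in the relative interior of
  every planar set that contains its triangle, so two tiles that share a unit triangle coincide.  The
  bound \<open>1 / 3\<close> is the difference between the coordinates of a center and those of the sides.\<close>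
lemma in_rel_interior_of_planar_set:
  fixes S :: "(real ^ 3) set"
  assumes "S \<subseteq> {v. (\<Sum>a\<in>UNIV. v $ a) = t}" "c \<in> S"
    and near: "\<And>v. (\<Sum>a\<in>UNIV. v $ a) = t \<Longrightarrow> (\<And>a. \<bar>v $ a - c $ a\<bar> < 1 / 3) \<Longrightarrow> v \<in> S"
  shows "c \<in> rel_interior S"
proof -
  have "affine {v :: real ^ 3. (\<Sum>a\<in>UNIV. v $ a) = t}"
    by (auto simp: affine_def sum.distrib sum_distrib_left[symmetric] distrib_right[symmetric])
  then have hull: "affine hull S \<subseteq> {v. (\<Sum>a\<in>UNIV. v $ a) = t}"
    using assms(1) by (simp add: hull_minimal)
  have "ball c (1 / 3) \<inter> affine hull S \<subseteq> S"
  proof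
    fix v assume v: "v \<in> ball c (1 / 3) \<inter> affine hull S"
    have "\<bar>v $ a - c $ a\<bar> < 1 / 3" for a
      using component_le_norm_cart[of "v - c" a] v by (simp add: dist_norm norm_minus_commute)
    then show "v \<in> S"
      using near hull v by blast
  qed
  then show ?thesis
    using assms(2) by (auto simp: mem_rel_interior_ball intro!: exI[of _ "1 / 3"])
qed

lemma up_center_in_rel_interior:
  assumes "up_triangle x \<subseteq> S" "S \<subseteq> {v. (\<Sum>a\<in>UNIV. v $ a) = t}"
  shows "up_center x \<in> rel_interior S"
proof (rule in_rel_interior_of_planar_set[OF assms(2)])
  show "up_center x \<in> S"
    using assms(1) up_center_in by blast
  then have t: "(\<Sum>a\<in>UNIV. x $ a) + 1 = t"
    using assms(2) by (auto simp: up_center_def sum_3)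
  fix v :: "real ^ 3"
  assume v: "(\<Sum>a\<in>UNIV. v $ a) = t" "\<And>a. \<bar>v $ a - up_center x $ a\<bar> < 1 / 3"
  have "x $ a \<le> v $ a" for a
    using v(2)[of a] by (auto simp: up_center_def abs_if split: if_splits)
  then show "v \<in> S"
    using assms(1) t v(1) by (auto simp: mem_up_triangle)
qed

lemma down_center_in_rel_interior:
  assumes "down_triangle y \<subseteq> S" "S \<subseteq> {v. (\<Sum>a\<in>UNIV. v $ a) = t}"
  shows "down_center y \<in> rel_interior S"
proof (rule in_rel_interior_of_planar_set[OF assms(2)])
  show "down_center y \<in> S"
    using assms(1) down_center_in by blast
  then have t: "(\<Sum>a\<in>UNIV. y $ a) + 2 = t"
    using assms(2) by (auto simp: down_center_def sum_3)
  fix v :: "real ^ 3"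
  assume v: "(\<Sum>a\<in>UNIV. v $ a) = t" "\<And>a. \<bar>v $ a - down_center y $ a\<bar> < 1 / 3"
  have "v $ a \<le> y $ a + 1" for a
    using v(2)[of a] by (auto simp: down_center_def abs_if split: if_splits)
  then show "v \<in> S"
    using assms(1) t v(1) by (auto simp: mem_down_triangle)
qed

lemma up_center_in_rhombus:
  assumes "x \<in> up_positions n" "y \<in> down_positions n" "up_center x \<in> rhombus y d"
  shows "x = y + axis d 1"
  using assms up_center_in_up_triangle[OF assms(1) down_positions_raise[OF assms(2)]]
    up_center_not_in_down_triangle by (auto simp: rhombus_def)

lemma down_center_in_rhombus:
  assumes "y \<in> down_positions n" "y' \<in> down_positions n" "down_center y \<in> rhombus y' d"
  shows "y' = y"
  using assms down_center_in_down_triangle[OF assms(1,2)]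
    down_center_not_in_up_triangle[OF down_positions_raise[OF assms(2)] assms(1)]
  by (auto simp: rhombus_def)

locale numbered_tiling =
  fixes n :: nat and T :: "(real ^ 3) set set" and p :: "nat \<Rightarrow> real ^ 3"
  assumes tiling: "lozenge_tiling n T" and numbering: "numbering n T p"
begin

lemma tile_cases:
  assumes "Q \<in> T"
  obtains (triangle) x where "x \<in> up_positions n" "Q = up_triangle x"
    | (rhombus) y d where "y \<in> down_positions n" "Q = rhombus y d"
  using assms tiling unfolding lozenge_tiling_def up_triangles_def
  by (metis UnE image_iff subsetD unit_rhombi_iff)

lemma tile_planar:
  assumes "Q \<in> T"
  shows "Q \<subseteq> {v. (\<Sum>a\<in>UNIV. v $ a) = real n}"
  using assms tiling unfolding lozenge_tiling_def dilated_triangle_def by blast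

lemma tiles_meet_imp_eq:
  assumes "Q \<in> T" "Q' \<in> T" "v \<in> rel_interior Q" "v \<in> rel_interior Q'"
  shows "Q = Q'"
  using assms tiling unfolding lozenge_tiling_def pairwise_def by blast

lemma tile_of_up_triangle_unique:
  assumes "Q \<in> T" "Q' \<in> T" "up_triangle x \<subseteq> Q" "up_triangle x \<subseteq> Q'"
  shows "Q = Q'"
  using assms tiles_meet_imp_eq up_center_in_rel_interior tile_planar by metis

lemma tile_of_down_triangle_unique:
  assumes "Q \<in> T" "Q' \<in> T" "down_triangle y \<subseteq> Q" "down_triangle y \<subseteq> Q'"
  shows "Q = Q'"
  using assms tiles_meet_imp_eq down_center_in_rel_interior tile_planar by metis

definition mate :: "real ^ 3 \<Rightarrow> 3" where
  "mate y = (SOME d. rhombus y d \<in> T)"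

text \<open>A downward triangle is not a tile by itself, so the tile that covers its center is a rhombus.\<close>
lemma rhombus_mate:
  assumes "y \<in> down_positions n"
  shows "rhombus y (mate y) \<in> T"
proof -
  have "0 \<le> y $ a" for a
    using down_positionsD(1)[OF assms, of a] by (auto elim: Nats_cases)
  then have "down_center y \<in> dilated_triangle n"
    using down_positionsD(2)[OF assms] by (simp add: dilated_triangle_def down_center_def sum_3)
  then have "down_center y \<in> \<Union>T"
    using tiling by (simp add: lozenge_tiling_def)
  then obtain Q where Q: "Q \<in> T" "down_center y \<in> Q"
    by blast
  from Q(1) have "\<exists>d. rhombus y d \<in> T"
  proof (cases rule: tile_cases)
    case (triangle x)
    then show ?thesis
      using Q assms down_center_not_in_up_triangle by blast
  next
    case (rhombus y' d)
    then have "y' = y"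
      using down_center_in_rhombus[OF assms] Q by blast
    then show ?thesis
      using rhombus Q by blast
  qed
  then show ?thesis
    unfolding mate_def by (rule someI_ex)
qed

lemma rhombus_tile_mate:
  assumes "y \<in> down_positions n" "rhombus y d \<in> T"
  shows "d = mate y"
proof -
  have "rhombus y d = rhombus y (mate y)"
    using tile_of_down_triangle_unique[OF assms(2) rhombus_mate[OF assms(1)], of y]
    by (auto simp: rhombus_def)
  then have "up_center (y + axis d 1) \<in> rhombus y (mate y)"
    using up_center_in[of "y + axis d 1"] by (auto simp: rhombus_def)
  then have "y + axis d 1 = y + axis (mate y) 1"
    using up_center_in_rhombus down_positions_raise assms(1) by blast
  then show ?thesis
    by (simp add: axis_eq_axis)
qed

lemma unit_up: "i \<in> {1..n} \<Longrightarrow> p i \<in> up_positions n"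
  and unit_tile: "i \<in> {1..n} \<Longrightarrow> up_triangle (p i) \<in> T"
  and inj_on_numbering: "inj_on p {1..n}"
  using numbering by (auto simp: numbering_def bij_betw_def)

sublocale rhombus_matching n mate "p ` {1..n}"
proof
  show "inj_on (\<lambda>y. y + axis (mate y) 1) (down_positions n)"
  proof
    fix y y' assume y: "y \<in> down_positions n" "y' \<in> down_positions n"
      "y + axis (mate y) 1 = y' + axis (mate y') 1"
    have "rhombus y (mate y) = rhombus y' (mate y')"
      using tile_of_up_triangle_unique[OF rhombus_mate[OF y(1)] rhombus_mate[OF y(2)],
          of "y + axis (mate y) 1"] y(3) by (auto simp: rhombus_def)
    then have "down_center y \<in> rhombus y' (mate y')"
      using down_center_in by (auto simp: rhombus_def)
    then show "y = y'"
      using down_center_in_rhombus y by blast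
  qed
  show "p ` {1..n} \<subseteq> up_positions n"
    using unit_up by blast
  show "y + axis (mate y) 1 \<notin> p ` {1..n}" if y: "y \<in> down_positions n" for y
  proof
    assume "y + axis (mate y) 1 \<in> p ` {1..n}"
    then have "up_triangle (y + axis (mate y) 1) \<in> T"
      using unit_tile by auto
    then have "up_triangle (y + axis (mate y) 1) = rhombus y (mate y)"
      using tile_of_up_triangle_unique[OF _ rhombus_mate[OF y], of _ "y + axis (mate y) 1"]
      by (auto simp: rhombus_def)
    then have "down_center y \<in> up_triangle (y + axis (mate y) 1)"
      using down_center_in by (auto simp: rhombus_def)
    then show False
      using down_center_not_in_up_triangle[OF down_positions_raise[OF y] y] by blast
  qed
  show "card (p ` {1..n}) = n"
    using inj_on_numbering by (simp add: card_image)
qed simp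

section \<open>Colors spread along rays\<close>

text \<open>The tile just crossed must be remembered: it tells apart the two sides of a rhombus in direction
  \<open>c\<close>, and thus prevents a color from turning back.\<close>
lemma spreads_along_ray:
  assumes "spreads n T (up_triangle x) Q s" "x \<in> p ` {1..n}"
  obtains c k where "real k \<le> x $ c" "s = up_side c (ray c x k)"
    "Q \<in> T" "up_triangle (ray c x k) \<subseteq> Q"
proof -
  have "\<exists>c k. real k \<le> x $ c \<and> s = up_side c (ray c x k) \<and> Q \<in> T \<and> up_triangle (ray c x k) \<subseteq> Q"
    using assms(1)
  proof induction
    case (start s)
    then obtain c where "s = up_side c x"
      by (auto simp: edge_of_up_triangle_iff)
    moreover have "0 \<le> x $ c"
      using units_Nats[OF assms(2), of c] by (auto elim: Nats_cases)
    ultimately show ?case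
      using assms(2) unit_tile by (intro exI[of _ c] exI[of _ 0]) (auto simp: ray_0)
  next
    case (cross Q s R s')
    then obtain c k where k: "real k \<le> x $ c" "s = up_side c (ray c x k)"
      "Q \<in> T" "up_triangle (ray c x k) \<subseteq> Q"
      by blast
    obtain y d where R: "y \<in> down_positions n" "R = rhombus y d"
      using cross.hyps(3) by (auto simp: unit_rhombi_iff)
    have d: "d = mate y"
      using rhombus_tile_mate R cross.hyps(2) by blast
    have "up_side c (ray c x k) edge_of rhombus y d"
      using cross.hyps(5) k R by (simp add: opposite_sides_def)
    note edge = rhombus_edgeD[OF this]
    \<comment> \<open>Of the two sides of \<open>R\<close> in direction \<open>c\<close>, the one at \<open>y + axis d 1\<close> is behind: there the
      upward triangle above the side is half of \<open>R\<close>, whereas the color arrives from the other tile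
      \<open>Q\<close>.\<close>
    have "ray c x k \<noteq> y + axis d 1"
    proof
      assume "ray c x k = y + axis d 1"
      then have "up_triangle (ray c x k) \<subseteq> R"
        using R by (simp add: rhombus_def)
      then show False
        using tile_of_up_triangle_unique k cross.hyps(2,4) by blast
    qed
    then have z: "ray c x k = y + axis c 1"
      using edge by simp
    have "0 \<le> y $ c"
      using down_positionsD(1)[OF R(1), of c] by (auto elim: Nats_cases)
    moreover have "y $ c + 1 = x $ c - real k"
      using ray_level[OF assms(2) k(1)] z by simp
    ultimately have Suc: "real (Suc k) \<le> x $ c"
      by simp
    obtain t where t: "s' = up_side c (ray c x k + t)" "s' edge_of rhombus y d" "s \<noteq> s'"
      using cross.hyps(5) k(2) R by (auto simp: opposite_sides_def translate_up_side)
    have "ray c x k + t = y + axis d 1"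
      using rhombus_edgeD(2)[of c "ray c x k + t" y d] t k(2) z by auto
    moreover have "ray c x (Suc k) = y + axis d 1"
      using z d by (simp add: ray_Suc step_def)
    ultimately show ?case
      using Suc t(1) R cross.hyps(2)
      by (intro exI[of _ c] exI[of _ "Suc k"]) (auto simp: rhombus_def)
  qed
  then show ?thesis
    using that by blast
qed

lemma ray_spreads:
  assumes "x \<in> p ` {1..n}" "real k \<le> x $ c"
  obtains Q where "spreads n T (up_triangle x) Q (up_side c (ray c x k))"
    "Q \<in> T" "up_triangle (ray c x k) \<subseteq> Q"
proof -
  have "\<exists>Q. spreads n T (up_triangle x) Q (up_side c (ray c x k)) \<and> Q \<in> T \<and> up_triangle (ray c x k) \<subseteq> Q"
    using assms(2)
  proof (induction k)
    case 0
    have "spreads n T (up_triangle x) (up_triangle x) (up_side c x)"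
      by (rule spreads.start) (auto simp: edge_of_up_triangle_iff)
    then show ?case
      using assms(1) unit_tile by (auto simp: ray_0)
  next
    case (Suc k)
    then obtain Q where Q: "spreads n T (up_triangle x) Q (up_side c (ray c x k))"
      "Q \<in> T" "up_triangle (ray c x k) \<subseteq> Q"
      by auto
    obtain y where y: "y \<in> down_positions n" "ray c x k = y + axis c 1"
      "ray c x (Suc k) = y + axis (mate y) 1" "mate y \<noteq> c"
      by (rule ray_cross[OF assms(1) Suc.prems])
    let ?R = "rhombus y (mate y)"
    have ne: "?R \<noteq> Q"
    proof
      assume "?R = Q"
      then have "up_center (y + axis c 1) \<in> ?R"
        using Q(3) y(2) up_center_in by auto
      then have "y + axis c 1 = y + axis (mate y) 1"
        using up_center_in_rhombus down_positions_raise y(1) by blast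
      then show False
        using y(4) by (simp add: axis_eq_axis)
    qed
    have opposite: "opposite_sides ?R (up_side c (y + axis c 1)) (up_side c (y + axis (mate y) 1))"
      unfolding opposite_sides_def
    proof (intro conjI exI)
      show "up_side c (y + axis c 1) edge_of ?R" "up_side c (y + axis (mate y) 1) edge_of ?R"
        using up_side_edge_of_rhombus y(4) by metis+
      show "up_side c (y + axis c 1) \<noteq> up_side c (y + axis (mate y) 1)"
        using up_side_inject(2)[of c "y + axis c 1" c "y + axis (mate y) 1"] y(4)
        by (auto simp: axis_eq_axis)
      show "up_side c (y + axis (mate y) 1) = (+) (axis (mate y) 1 - axis c 1) ` up_side c (y + axis c 1)"
        unfolding translate_up_side by simp
    qed
    have R: "?R \<in> T" "?R \<in> unit_rhombi n"
      using rhombus_mate[OF y(1)] y(1) unit_rhombi_iff by blast+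
    have "spreads n T (up_triangle x) ?R (up_side c (y + axis (mate y) 1))"
      by (rule spreads.cross[OF Q(1)[unfolded y(2)] R ne opposite])
    then show ?case
      using y rhombus_mate[OF y(1)] by (auto simp: rhombus_def)
  qed
  then show ?thesis
    using that by blast
qed

text \<open>The side in direction \<open>c\<close> of the upward triangle at this position is the segment of the edge of the
  big triangle on which color \<open>i\<close> arrives.\<close>
definition landing :: "3 \<Rightarrow> nat \<Rightarrow> real ^ 3" where
  "landing c i = endpoint c (p i)"

lemma landing_up:
  assumes "i \<in> {1..n}"
  shows "landing c i \<in> up_positions n" "landing c i $ c = 0"
  using endpoint_up[of "p i" c] assms by (auto simp: landing_def)

lemma landing_image: "landing c ` {1..n} = {z \<in> up_positions n. z $ c = 0}"
  using endpoint_image[of c] by (simp add: landing_def image_image)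

text \<open>Rays in the same direction are disjoint, so no other color arrives at this segment.\<close>
lemma received_landing:
  assumes "i \<in> {1..n}"
  shows "received n T p (up_side c (landing c i)) = i"
  unfolding received_def landing_def
proof (rule the_equality)
  obtain k where k: "p i $ c = real k"
    by (rule units_natE[of "p i"]) (use assms in auto)
  then show "i \<in> {1..n} \<and> (\<exists>Q. spreads n T (up_triangle (p i)) Q (up_side c (endpoint c (p i))))"
    using assms ray_spreads[of "p i" k c] endpoint_eq_ray[OF k] by auto
  fix j assume j: "j \<in> {1..n} \<and> (\<exists>Q. spreads n T (up_triangle (p j)) Q (up_side c (endpoint c (p i))))"
  then obtain Q where "spreads n T (up_triangle (p j)) Q (up_side c (endpoint c (p i)))"
    by blast
  then obtain c' l where l: "real l \<le> p j $ c'" "up_side c (endpoint c (p i)) = up_side c' (ray c' (p j) l)"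
    using j by (elim spreads_along_ray) auto
  have "c' = c" "ray c' (p j) l = ray c (p i) k"
    using up_side_inject[OF l(2)] endpoint_eq_ray[OF k] by auto
  then have "p j = p i"
    using ray_disjoint[of "p j" "p i" l c k] j assms l(1) k by auto
  then show "j = i"
    using inj_on_numbering j assms by (auto dest: inj_onD)
qed

lemma edge_segment_up_side:
  assumes "a \<noteq> b" "a \<noteq> c" "b \<noteq> c" "z \<in> up_positions n" "z $ c = 0" "z $ b = real j"
  shows "edge_segment n a b j = up_side c z"
proof -
  have "z $ a = real n - 1 - real j"
    using up_positionsD(2)[OF assms(4)] assms by (simp add: three_directions(2)[of a b c])
  then have "axis a (real n - real j) + axis b (real j) = z + axis a 1"
    "axis a (real n - real (Suc j)) + axis b (real (Suc j)) = z + axis b 1"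
    using assms by (auto simp: vec_eq_iff three_directions(1)[of a b c] axis_def)
  then show ?thesis
    using assms by (simp add: edge_segment_def up_side_segment[of a b c])
qed

lemma edge_word_nth:
  assumes "a \<noteq> b" "a \<noteq> c" "b \<noteq> c" "i \<in> {1..n}" "j < n" "landing c i $ b = real j"
  shows "edge_word n T p a b ! j = i"
proof -
  have "edge_segment n a b j = up_side c (landing c i)"
    using assms landing_up by (intro edge_segment_up_side[OF assms(1-3)]) auto
  then show ?thesis
    using received_landing[OF assms(4)] assms(5) by (simp add: edge_word_def)
qed

lemma edge_word_entry:
  assumes "a \<noteq> b" "a \<noteq> c" "b \<noteq> c" "j < n"
  shows "edge_word n T p a b ! j \<in> {1..n}" "landing c (edge_word n T p a b ! j) $ b = real j"
proof -
  define z :: "real ^ 3" where "z = axis a (real (n - 1 - j)) + axis b (real j)"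
  have z: "z \<in> up_positions n" "z $ c = 0" "z $ b = real j"
    using assms by (auto simp: z_def up_positions_def three_directions(1)[of a b c]
        three_directions(2)[of a b c] axis_def of_nat_diff)
  then have "z \<in> landing c ` {1..n}"
    unfolding landing_image by simp
  then obtain i where "i \<in> {1..n}" "landing c i = z"
    by blast
  then show "edge_word n T p a b ! j \<in> {1..n}" "landing c (edge_word n T p a b ! j) $ b = real j"
    using edge_word_nth[OF assms(1-3) _ assms(4), of i] z(3) by auto
qed

lemma landing_natE:
  assumes "i \<in> {1..n}" "b \<noteq> c"
  obtains j where "j < n" "landing c i $ b = real j"
proof -
  note z = landing_up[OF assms(1), of c]
  obtain a where a: "a \<noteq> b" "a \<noteq> c"
    using third_direction[OF assms(2)] .
  obtain j where j: "landing c i $ b = real j"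
    using up_positionsD(1)[OF z(1), of b] by (auto elim: Nats_cases)
  obtain j' where j': "landing c i $ a = real j'"
    using up_positionsD(1)[OF z(1), of a] by (auto elim: Nats_cases)
  have "j < n"
    using up_positionsD(2)[OF z(1)] z(2) a assms(2) j j' by (simp add: three_directions(2)[of a b c])
  then show ?thesis
    using that j by blast
qed

lemma landing_eqI:
  assumes "i \<in> {1..n}" "z \<in> up_positions n" "z $ c = 0" "a \<noteq> c" "landing c i $ a = z $ a"
  shows "landing c i = z"
  using assms landing_up[OF assms(1), of c] by (intro up_positions_eqI[of _ n _ a c]) auto

lemma inj_on_landing: "inj_on (landing c) {1..n}"
  using comp_inj_on[OF inj_on_numbering inj_on_endpoint[of c]] unfolding landing_def comp_def .

lemma inj_on_landing_coordinate:
  assumes "a \<noteq> c"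
  shows "inj_on (\<lambda>i. landing c i $ a) {1..n}"
proof
  fix i j assume *: "i \<in> {1..n}" "j \<in> {1..n}" "landing c i $ a = landing c j $ a"
  then have "landing c i = landing c j"
    using landing_up assms by (intro landing_eqI) auto
  then show "i = j"
    using inj_onD[OF inj_on_landing] * by blast
qed

theorem position_eq_card_farther:
  assumes "i \<in> {1..n}"
  shows "p i $ a = real (card {j \<in> {1..n}. \<forall>b. b \<noteq> a \<longrightarrow> landing b j $ a < landing b i $ a})"
proof -
  let ?F = "{j \<in> {1..n}. \<forall>b. b \<noteq> a \<longrightarrow> landing b j $ a < landing b i $ a}"
  have "farther a (p i) = p ` ?F"
    unfolding farther_def landing_def by auto
  moreover have "card (p ` ?F) = card ?F"
    by (rule card_image, rule inj_on_subset[OF inj_on_numbering]) blast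
  ultimately show ?thesis
    using coordinate_eq_card_farther[of "p i" a] assms by simp
qed

end

text \<open>An edge word and the list of places where the colors arrive on that edge are inverse to each other.\<close>
lemma edge_word_eq_iff:
  assumes T: "numbered_tiling n T p" and T': "numbered_tiling n T' p'"
    and abc: "a \<noteq> b" "a \<noteq> c" "b \<noteq> c"
  shows "edge_word n T p a b = edge_word n T' p' a b \<longleftrightarrow>
    (\<forall>i\<in>{1..n}. numbered_tiling.landing T p c i = numbered_tiling.landing T' p' c i)"
proof -
  interpret X: numbered_tiling n T p by (rule T)
  interpret Y: numbered_tiling n T' p' by (rule T')
  show ?thesis
  proof (intro iffI ballI)
    fix i assume eq: "edge_word n T p a b = edge_word n T' p' a b" and i: "i \<in> {1..n}"
    obtain j where j: "j < n" "X.landing c i $ b = real j"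
      by (rule X.landing_natE[OF i abc(3)])
    have "edge_word n T' p' a b ! j = i"
      using X.edge_word_nth[OF abc i j] eq by simp
    then have "Y.landing c i $ b = real j"
      using Y.edge_word_entry(2)[OF abc j(1)] by simp
    then show "X.landing c i = Y.landing c i"
      using Y.landing_up[OF i] j abc by (intro X.landing_eqI[OF i, of _ _ b]) auto
  next
    assume eq: "\<forall>i\<in>{1..n}. X.landing c i = Y.landing c i"
    show "edge_word n T p a b = edge_word n T' p' a b"
    proof (rule nth_equalityI)
      fix j assume "j < length (edge_word n T p a b)"
      then have j: "j < n"
        by (simp add: edge_word_def)
      show "edge_word n T p a b ! j = edge_word n T' p' a b ! j"
        using X.edge_word_entry[OF abc j] eq by (intro Y.edge_word_nth[OF abc _ j, symmetric]) auto
    qed (simp add: edge_word_def)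
  qed
qed

section \<open>Orders from inversion counts, and the result\<close>

text \<open>The numbers of non-inversions form a Lehmer code of the order given by \<open>g\<close> relative to the one given
  by \<open>f\<close>, and a Lehmer code determines the order.  Elements are inserted in the order of \<open>f\<close>: the code
  of a new element is its rank among the earlier ones.\<close>
lemma order_determined_by_noninversions:
  fixes f g h :: "'a \<Rightarrow> real"
  assumes "finite S" "inj_on f S" "inj_on g S" "inj_on h S"
    and "\<And>i. i \<in> S \<Longrightarrow> card {j \<in> S. f j < f i \<and> g j < g i} = card {j \<in> S. f j < f i \<and> h j < h i}"
    and "i \<in> S" "j \<in> S"
  shows "g j < g i \<longleftrightarrow> h j < h i"
  using assms
proof (induction S arbitrary: i j rule: finite_ranking_induct[where f = f])
  case (insert x S)
  show ?case
  proof (cases "x \<in> S")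
    case True
    then have "insert x S = S"
      by (rule insert_absorb)
    note prems = insert.prems[unfolded this]
    show ?thesis
      by (rule insert.IH[OF prems(1-3) _ prems(5,6)]) (rule prems(4))
  next
    case new: False
    have less: "f y < f x" if "y \<in> S" for y
    proof -
      have "f y \<noteq> f x"
        using inj_onD[OF insert.prems(1), of y x] new that by auto
      then show ?thesis
        using insert.hyps(2)[OF that] by simp
    qed
    have old: "g j < g i \<longleftrightarrow> h j < h i" if "i \<in> S" "j \<in> S" for i j
    proof (rule insert.IH)
      have *: "{j \<in> insert x S. f j < f i \<and> k j < k i} = {j \<in> S. f j < f i \<and> k j < k i}"
        if "i \<in> S" for i and k :: "'a \<Rightarrow> real"
        using less[OF that] by auto
      show "card {j \<in> S. f j < f i \<and> g j < g i} = card {j \<in> S. f j < f i \<and> h j < h i}"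
        if "i \<in> S" for i
        using insert.prems(4)[of i] *[OF that] that by simp
    qed (use that inj_on_subset[OF insert.prems(1)] inj_on_subset[OF insert.prems(2)]
          inj_on_subset[OF insert.prems(3)] in auto)
    let ?G = "{j \<in> S. g j < g x}" and ?H = "{j \<in> S. h j < h x}"
    have "{j \<in> insert x S. f j < f x \<and> k j < k x} = {j \<in> S. k j < k x}" for k :: "'a \<Rightarrow> real"
      using less by auto
    then have card: "card ?G = card ?H"
      using insert.prems(4)[of x] by simp
    \<comment> \<open>Both are initial segments of the order on \<open>S\<close> on which \<open>g\<close> and \<open>h\<close> agree already, so one
      contains the other; having the same size, they are equal.\<close>
    have "?G \<subseteq> ?H \<or> ?H \<subseteq> ?G"
    proof (rule ccontr)
      assume "\<not> (?G \<subseteq> ?H \<or> ?H \<subseteq> ?G)"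
      then obtain y z where y: "y \<in> S" "g y < g x" "\<not> h y < h x"
        and z: "z \<in> S" "h z < h x" "\<not> g z < g x"
        by blast
      then have "g y < g z" "h z < h y"
        by auto
      then show False
        using old[OF z(1) y(1)] by simp
    qed
    then have GH: "?G = ?H"
      using card insert.hyps(1) by (auto dest: card_subset_eq[rotated])
    have x: "g y < g x \<longleftrightarrow> h y < h x" if "y \<in> S" for y
      using GH that by blast
    have x': "g x < g y \<longleftrightarrow> h x < h y" if "y \<in> S" for y
    proof -
      have "g x \<noteq> g y" "h x \<noteq> h y"
        using inj_onD[OF insert.prems(2), of x y] inj_onD[OF insert.prems(3), of x y] that new
        by auto
      then show ?thesis
        using x[OF that] by auto
    qed
    show ?thesis
      using insert.prems(5,6) old x x' by auto
  qed
qed simp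

lemma eq_if_same_order_and_image:
  fixes g h :: "'a \<Rightarrow> real"
  assumes "finite S" "inj_on g S" "inj_on h S" "g ` S = h ` S"
    and order: "\<And>i j. i \<in> S \<Longrightarrow> j \<in> S \<Longrightarrow> g j < g i \<longleftrightarrow> h j < h i"
    and "i \<in> S"
  shows "g i = h i"
proof -
  let ?below = "\<lambda>t. {v \<in> g ` S. v < t}"
  have "?below (g i) = g ` {j \<in> S. g j < g i}"
    by auto
  moreover have "?below (h i) = h ` {j \<in> S. g j < g i}"
    unfolding assms(4) using order[OF \<open>i \<in> S\<close>] by auto
  ultimately have card: "card (?below (g i)) = card (?below (h i))"
    using assms(2,3) by (simp add: card_image inj_on_subset)
  have strict: "card (?below s) < card (?below t)" if "s \<in> g ` S" "s < t" for s t
    using that assms(1) by (intro psubset_card_mono) auto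
  have "g i \<in> g ` S" "h i \<in> g ` S"
    using assms(4) \<open>i \<in> S\<close> by auto
  then show ?thesis
    using strict[of "g i" "h i"] strict[of "h i" "g i"] card by (metis less_irrefl linorder_neqE)
qed

text \<open>Let \<open>a\<close> be the vertex common to the edges opposite to \<open>b\<close> and \<open>c\<close>.  The coordinate \<open>a\<close> of unit \<open>i\<close>
  counts the colors farther from \<open>a\<close> on both edges, and these are non-inversions between the two
  orders of arrival.  So the known order on one edge and the positions determine the order on the
  other.\<close>
lemma positions_and_one_landing_determine_landings:
  assumes T: "numbered_tiling n T p" and T': "numbered_tiling n T' p'"
    and pos: "\<And>i. i \<in> {1..n} \<Longrightarrow> p i = p' i"
    and eq: "\<And>i. i \<in> {1..n} \<Longrightarrow> numbered_tiling.landing T p c i = numbered_tiling.landing T' p' c i"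
    and i: "i \<in> {1..n}"
  shows "numbered_tiling.landing T p b i = numbered_tiling.landing T' p' b i"
proof (cases "b = c")
  case False
  interpret X: numbered_tiling n T p by (rule T)
  interpret Y: numbered_tiling n T' p' by (rule T')
  obtain a where a: "a \<noteq> b" "a \<noteq> c"
    using third_direction[OF False] .
  let ?f = "\<lambda>i. X.landing c i $ a" and ?g = "\<lambda>i. X.landing b i $ a" and ?h = "\<lambda>i. Y.landing b i $ a"
  have inj: "inj_on ?f {1..n}" "inj_on ?g {1..n}" "inj_on ?h {1..n}"
    using X.inj_on_landing_coordinate Y.inj_on_landing_coordinate a by auto
  have "card {j \<in> {1..n}. ?f j < ?f i \<and> ?g j < ?g i} = card {j \<in> {1..n}. ?f j < ?f i \<and> ?h j < ?h i}"
    if i: "i \<in> {1..n}" for i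
  proof -
    have *: "(\<forall>d. d \<noteq> a \<longrightarrow> P d) \<longleftrightarrow> P c \<and> P b" for P
      using three_directions(1)[of a b c "\<lambda>d. d \<noteq> a \<longrightarrow> P d"] a False by auto
    have "{j \<in> {1..n}. Y.landing c j $ a < Y.landing c i $ a \<and> ?h j < ?h i} =
        {j \<in> {1..n}. ?f j < ?f i \<and> ?h j < ?h i}"
      using eq i by auto
    then show ?thesis
      using X.position_eq_card_farther[OF i, of a] Y.position_eq_card_farther[OF i, of a] pos[OF i]
      unfolding * by simp
  qed
  then have order: "?g j < ?g i \<longleftrightarrow> ?h j < ?h i" if "i \<in> {1..n}" "j \<in> {1..n}" for i j
    using order_determined_by_noninversions[OF finite_atLeastAtMost inj] that by blast
  have "?g ` {1..n} = ?h ` {1..n}"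
    using arg_cong[OF X.landing_image[of b, folded Y.landing_image], of "image (\<lambda>z. z $ a)"]
    unfolding image_image .
  then have "?g i = ?h i"
    using eq_if_same_order_and_image[OF finite_atLeastAtMost inj(2,3) _ order i] by blast
  then show ?thesis
    using Y.landing_up[OF i] a by (intro X.landing_eqI[OF i, of _ _ a]) auto
qed (use eq i in simp)

theorem theorem4p3:
  fixes n :: nat
    and T T' :: "(real ^ 3) set set"
    and p p' :: "nat \<Rightarrow> real ^ 3"
    and u v w u' v' w' :: "nat list"
  assumes "n \<ge> 1"
    and "lozenge_tiling n T" and "numbering n T p"
    and "lozenge_tiling n T'" and "numbering n T' p'"
    and "system_of_permutations n T p = (u, v, w)"
    and "system_of_permutations n T' p' = (u', v', w')"
  shows "((u, v, w) = (u', v', w') \<longrightarrow> (\<forall>i\<in>{1..n}. p i = p' i)) \<and>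
         ((\<forall>i\<in>{1..n}. p i = p' i) \<and> (u = u' \<or> v = v' \<or> w = w') \<longrightarrow> (u, v, w) = (u', v', w'))"
proof -
  have T: "numbered_tiling n T p" "numbered_tiling n T' p'"
    using assms by unfold_locales
  interpret X: numbered_tiling n T p by (rule T)
  interpret Y: numbered_tiling n T' p' by (rule T)
  define same where "same c \<longleftrightarrow> (\<forall>i\<in>{1..n}. X.landing c i = Y.landing c i)" for c
  have words: "u = u' \<longleftrightarrow> same 3" "v = v' \<longleftrightarrow> same 2" "w = w' \<longleftrightarrow> same 1"
    using assms(6,7) edge_word_eq_iff[OF T, of 2 1 3] edge_word_eq_iff[OF T, of 1 3 2]
      edge_word_eq_iff[OF T, of 3 2 1]
    by (auto simp: system_of_permutations_def same_def)
  have pos: "p i = p' i" if "same 1" "same 2" "same 3" "i \<in> {1..n}" for i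
  proof -
    have landings: "X.landing c j = Y.landing c j" if "j \<in> {1..n}" for c j
      using \<open>same 1\<close> \<open>same 2\<close> \<open>same 3\<close> that exhaust_3[of c] by (auto simp: same_def)
    have "{j \<in> {1..n}. \<forall>b. b \<noteq> a \<longrightarrow> X.landing b j $ a < X.landing b i $ a} =
        {j \<in> {1..n}. \<forall>b. b \<noteq> a \<longrightarrow> Y.landing b j $ a < Y.landing b i $ a}" for a
      using that(4) by (intro Collect_cong conj_cong refl) (simp add: landings)
    then show ?thesis
      using X.position_eq_card_farther[OF that(4)] Y.position_eq_card_farther[OF that(4)]
      by (simp add: vec_eq_iff)
  qed
  have spread: "same b" if "\<forall>i\<in>{1..n}. p i = p' i" "same c" for b c
    using positions_and_one_landing_determine_landings[OF T, of c] that unfolding same_def by blast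
  show ?thesis
  proof (intro conjI impI ballI)
    show "p i = p' i" if "(u, v, w) = (u', v', w')" "i \<in> {1..n}" for i
      using that(1) words by (intro pos[OF _ _ _ that(2)]) simp_all
    assume *: "(\<forall>i\<in>{1..n}. p i = p' i) \<and> (u = u' \<or> v = v' \<or> w = w')"
    then obtain c where "same c"
      unfolding words by blast
    then have "same b" for b
      using spread * by blast
    then show "(u, v, w) = (u', v', w')"
      using words by simp
  qed
qed

end
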